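(* For $N\geq 4$ the inclusion $(S_{N-1}^+)^{\leq S_N^+}\subset (S_{N}^+)_N$ is proper, where $$(S_{N-1}^+)^{\leq S_N^+}=\{\varphi\circ \pi_{N-1}\,:\,\varphi\text{ a state on }C(S_{N-1}^+)\},\qquad (S_{N}^+)_N=\{\varphi\text{ a state on }C(S_N^+)\,:\,\varphi(u_{NN})=1\}.$$
   Context: $C(S_N^+)$ is the universal unital $\mathrm{C}^*$-algebra generated by the entries of an $N\times N$ magic unitary $u=(u_{ij})$ (all $u_{ij}$ are projections and each row and column sums to $\mathds{1}$). $\pi_{N-1}:C(S_N^+)\to C(S_{N-1}^+)$ is the quotient $*$-homomorphism sending the matrix $u^{S_N^+}$ entrywise to the block-diagonal matrix $\begin{bmatrix} u^{S_{N-1}^+}&0\\0&\mathds{1}_{S_{N-1}^+}\end{bmatrix}$. *)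

theory Defs
  imports "HOL-Algebra.Module" "HOL-Library.Poly_Mapping" "HOL-Library.Nonpos_Ints" Complex_Main
begin

section \<open>Unital C*-algebras on a carrier set\<close>

record 'a cstar = "(complex, 'a) module" +
  star :: "'a \<Rightarrow> 'a"
  cnorm :: "'a \<Rightarrow> real"

locale cstar_algebra = ring A for A :: "('a, 'm) cstar_scheme" (structure) +
  assumes smult_closed [simp, intro]: "x \<in> carrier A \<Longrightarrow> c \<odot> x \<in> carrier A"
    and smult_l_distr: "x \<in> carrier A \<Longrightarrow> (c + d) \<odot> x = c \<odot> x \<oplus> d \<odot> x"
    and smult_r_distr: "x \<in> carrier A \<Longrightarrow> y \<in> carrier A \<Longrightarrow> c \<odot> (x \<oplus> y) = c \<odot> x \<oplus> c \<odot> y"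
    and smult_assoc: "x \<in> carrier A \<Longrightarrow> (c * d) \<odot> x = c \<odot> (d \<odot> x)"
    and smult_one [simp]: "x \<in> carrier A \<Longrightarrow> 1 \<odot> x = x"
    and smult_mult_left: "x \<in> carrier A \<Longrightarrow> y \<in> carrier A \<Longrightarrow> (c \<odot> x) \<otimes> y = c \<odot> (x \<otimes> y)"
    and smult_mult_right: "x \<in> carrier A \<Longrightarrow> y \<in> carrier A \<Longrightarrow> x \<otimes> (c \<odot> y) = c \<odot> (x \<otimes> y)"
    and star_closed [simp, intro]: "x \<in> carrier A \<Longrightarrow> star A x \<in> carrier A"
    and star_star [simp]: "x \<in> carrier A \<Longrightarrow> star A (star A x) = x"
    and star_add: "x \<in> carrier A \<Longrightarrow> y \<in> carrier A \<Longrightarrow> star A (x \<oplus> y) = star A x \<oplus> star A y"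
    and star_smult: "x \<in> carrier A \<Longrightarrow> star A (c \<odot> x) = cnj c \<odot> star A x"
    and star_mult: "x \<in> carrier A \<Longrightarrow> y \<in> carrier A \<Longrightarrow> star A (x \<otimes> y) = star A y \<otimes> star A x"
    and cnorm_triangle:
      "x \<in> carrier A \<Longrightarrow> y \<in> carrier A \<Longrightarrow> cnorm A (x \<oplus> y) \<le> cnorm A x + cnorm A y"
    and cnorm_smult: "x \<in> carrier A \<Longrightarrow> cnorm A (c \<odot> x) = cmod c * cnorm A x"
    and cnorm_eq_zero: "x \<in> carrier A \<Longrightarrow> cnorm A x = 0 \<Longrightarrow> x = \<zero>"
    and cnorm_mult:
      "x \<in> carrier A \<Longrightarrow> y \<in> carrier A \<Longrightarrow> cnorm A (x \<otimes> y) \<le> cnorm A x * cnorm A y"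
    and cstar_identity: "x \<in> carrier A \<Longrightarrow> cnorm A (star A x \<otimes> x) = (cnorm A x)\<^sup>2"
    and complete: "(\<And>n. X n \<in> carrier A) \<Longrightarrow>
      (\<And>e. e > 0 \<Longrightarrow> \<exists>M. \<forall>m\<ge>M. \<forall>n\<ge>M. cnorm A (X m \<ominus> X n) < e) \<Longrightarrow>
      \<exists>l\<in>carrier A. (\<lambda>n. cnorm A (X n \<ominus> l)) \<longlonglongrightarrow> 0"

definition cstar_hom :: "('a, 'm) cstar_scheme \<Rightarrow> ('b, 'n) cstar_scheme \<Rightarrow> ('a \<Rightarrow> 'b) set" where
  "cstar_hom A B = {f \<in> ring_hom A B. \<forall>x\<in>carrier A.
     f (star A x) = star B (f x) \<and> (\<forall>c. f (c \<odot>\<^bsub>A\<^esub> x) = c \<odot>\<^bsub>B\<^esub> f x)}"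

text \<open>Maps out of a carrier are compared as functions, so states are kept
  \<^const>\<open>extensional\<close> (constant outside the carrier).  For a positive functional on a unital
  C*-algebra, being of norm one is the same as being unital.\<close>

definition states :: "('a, 'm) cstar_scheme \<Rightarrow> ('a \<Rightarrow> complex) set" where
  "states A = {\<phi> \<in> extensional (carrier A).
     (\<forall>x\<in>carrier A. \<forall>y\<in>carrier A. \<phi> (x \<oplus>\<^bsub>A\<^esub> y) = \<phi> x + \<phi> y) \<and>
     (\<forall>c. \<forall>x\<in>carrier A. \<phi> (c \<odot>\<^bsub>A\<^esub> x) = c * \<phi> x) \<and>
     (\<forall>x\<in>carrier A. \<phi> (star A x \<otimes>\<^bsub>A\<^esub> x) \<in> \<real>\<^sub>\<ge>\<^sub>0) \<and>
     \<phi> \<one>\<^bsub>A\<^esub> = 1}"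

text \<open>Matrices over an algebra are functions on index pairs; only the entries with indices in
  \<open>{1..N}\<close> matter.\<close>

definition magic_unitary :: "('a, 'm) cstar_scheme \<Rightarrow> nat \<Rightarrow> (nat \<Rightarrow> nat \<Rightarrow> 'a) \<Rightarrow> bool" where
  "magic_unitary A N u \<longleftrightarrow>
     (\<forall>i\<in>{1..N}. \<forall>j\<in>{1..N}. u i j \<in> carrier A \<and> star A (u i j) = u i j
        \<and> u i j \<otimes>\<^bsub>A\<^esub> u i j = u i j) \<and>
     (\<forall>i\<in>{1..N}. (\<Oplus>\<^bsub>A\<^esub>j\<in>{1..N}. u i j) = \<one>\<^bsub>A\<^esub>) \<and>
     (\<forall>j\<in>{1..N}. (\<Oplus>\<^bsub>A\<^esub>i\<in>{1..N}. u i j) = \<one>\<^bsub>A\<^esub>)"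

section \<open>Universal C*-algebras given by generators and relations\<close>

text \<open>The free unital *-algebra on self-adjoint generators of type \<^typ>\<open>'g\<close> is the complex monoid
  algebra of words.  With concatenation as addition on lists, its product is the convolution
  product of \<^theory>\<open>HOL-Library.Poly_Mapping\<close>, and its unit is the empty word.\<close>

instantiation list :: (type) monoid_add
begin
definition zero_list :: "'a list" where "zero_list = []"
definition plus_list :: "'a list \<Rightarrow> 'a list \<Rightarrow> 'a list" where "plus_list = append"
instance by standard (simp_all add: zero_list_def plus_list_def)
end

type_synonym 'g falg = "'g list \<Rightarrow>\<^sub>0 complex"

definition gen :: "'g \<Rightarrow> 'g falg" where
  "gen g = Poly_Mapping.single [g] 1"

definition fscale :: "complex \<Rightarrow> 'g falg \<Rightarrow> 'g falg" where
  "fscale c a = Poly_Mapping.map ((*) c) a"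

text \<open>The generators are self-adjoint, so the involution reverses words and conjugates
  coefficients.\<close>

definition fstar :: "'g falg \<Rightarrow> 'g falg" where
  "fstar a = Poly_Mapping.map cnj (Poly_Mapping.map_key rev a)"

definition cstar_seminorm :: "('g falg \<Rightarrow> real) \<Rightarrow> bool" where
  "cstar_seminorm p \<longleftrightarrow>
     (\<forall>a b. p (a + b) \<le> p a + p b) \<and> (\<forall>c a. p (fscale c a) = cmod c * p a) \<and>
     (\<forall>a b. p (a * b) \<le> p a * p b) \<and> (\<forall>a. p (fstar a * a) = (p a)\<^sup>2)"

text \<open>The universal C*-algebra on generators subject to relations \<open>r = 0\<close> for \<open>r \<in> R\<close>
  is the separation and completion of the free *-algebra in the largest C*-seminorm that vanishes
  on \<open>R\<close>.  The supremum is meaningful only if the generators are uniformly bounded, which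
  \<open>magic_bdd\<close> shows for the relations used here.\<close>

definition admissible :: "'g falg set \<Rightarrow> ('g falg \<Rightarrow> real) set" where
  "admissible R = {p. cstar_seminorm p \<and> (\<forall>r\<in>R. p r = 0)}"

definition universal_seminorm :: "'g falg set \<Rightarrow> 'g falg \<Rightarrow> real" where
  "universal_seminorm R a = (SUP p\<in>admissible R. p a)"

text \<open>Elements of the completion are classes of Cauchy sequences modulo sequences tending to
  zero; the operations are computed on representatives, see \<open>completion_ops\<close> and
  \<open>completion_ops2\<close>.\<close>

definition cauchy_seqs :: "('g falg \<Rightarrow> real) \<Rightarrow> (nat \<Rightarrow> 'g falg) set" where
  "cauchy_seqs p = {X. \<forall>e>0. \<exists>M. \<forall>m\<ge>M. \<forall>n\<ge>M. p (X m - X n) < e}"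

definition seq_class :: "('g falg \<Rightarrow> real) \<Rightarrow> (nat \<Rightarrow> 'g falg) \<Rightarrow> (nat \<Rightarrow> 'g falg) set" where
  "seq_class p X = {Y \<in> cauchy_seqs p. (\<lambda>n. p (X n - Y n)) \<longlonglongrightarrow> 0}"

definition rep :: "'b set \<Rightarrow> 'b" where
  "rep x = (SOME X. X \<in> x)"

definition completion :: "('g falg \<Rightarrow> real) \<Rightarrow> (nat \<Rightarrow> 'g falg) set cstar" where
  "completion p = \<lparr>
     carrier = seq_class p ` cauchy_seqs p,
     mult = (\<lambda>x y. seq_class p (\<lambda>n. rep x n * rep y n)),
     one = seq_class p (\<lambda>n. 1),
     zero = seq_class p (\<lambda>n. 0),
     add = (\<lambda>x y. seq_class p (\<lambda>n. rep x n + rep y n)),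
     smult = (\<lambda>c x. seq_class p (\<lambda>n. fscale c (rep x n))),
     star = (\<lambda>x. seq_class p (\<lambda>n. fstar (rep x n))),
     cnorm = (\<lambda>x. lim (\<lambda>n. p (rep x n)))\<rparr>"

section \<open>The C*-algebra of the quantum permutation group\<close>

text \<open>The generator type also contains \<open>(i, j)\<close> with an index outside \<open>{1..N}\<close>; those
  superfluous generators are set to zero.\<close>

definition magic_relations :: "nat \<Rightarrow> (nat \<times> nat) falg set" where
  "magic_relations N =
     {gen (i, j) * gen (i, j) - gen (i, j) |i j. i \<in> {1..N} \<and> j \<in> {1..N}} \<union>
     {(\<Sum>j=1..N. gen (i, j)) - 1 |i. i \<in> {1..N}} \<union>
     {(\<Sum>i=1..N. gen (i, j)) - 1 |j. j \<in> {1..N}} \<union>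
     {gen (i, j) |i j. \<not> (i \<in> {1..N} \<and> j \<in> {1..N})}"

definition C_qperm :: "nat \<Rightarrow> (nat \<Rightarrow> (nat \<times> nat) falg) set cstar" where
  "C_qperm N = completion (universal_seminorm (magic_relations N))"

definition qperm_gen :: "nat \<Rightarrow> nat \<Rightarrow> nat \<Rightarrow> (nat \<Rightarrow> (nat \<times> nat) falg) set" where
  "qperm_gen N i j = seq_class (universal_seminorm (magic_relations N)) (\<lambda>n. gen (i, j))"

section \<open>Verification of the construction\<close>

subsection \<open>The free *-algebra\<close>

lemma fscale_single_mult: "fscale c a = Poly_Mapping.single 0 c * a"
  unfolding fscale_def by (rule mult_map_scale_conv_mult)

lemma lookup_fscale: "Poly_Mapping.lookup (fscale c a) w = c * Poly_Mapping.lookup a w"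
  unfolding fscale_def by (simp add: Poly_Mapping.map.rep_eq when_def)

lemma lookup_fstar: "Poly_Mapping.lookup (fstar a) w = cnj (Poly_Mapping.lookup a (rev w))"
  unfolding fstar_def by (simp add: Poly_Mapping.map.rep_eq map_key.rep_eq when_def)

lemma fscale_add: "fscale c (a + b) = fscale c a + fscale c b"
  by (simp add: fscale_single_mult distrib_left)

lemma fscale_add_left: "fscale (c + d) a = fscale c a + fscale d a"
  by (rule poly_mapping_eqI) (simp add: lookup_fscale lookup_add distrib_right)

lemma fscale_fscale: "fscale c (fscale d a) = fscale (c * d) a"
  by (rule poly_mapping_eqI) (simp add: lookup_fscale)

lemma fscale_1 [simp]: "fscale 1 a = a"
  by (rule poly_mapping_eqI) (simp add: lookup_fscale)

lemma fscale_single: "fscale c (Poly_Mapping.single w d) = Poly_Mapping.single w (c * d)"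
  by (simp add: fscale_single_mult mult_single)

lemma fscale_mult_left: "fscale c a * b = fscale c (a * b)"
  by (simp add: fscale_single_mult mult.assoc)

lemma fstar_add: "fstar (a + b) = fstar a + fstar b"
  by (rule poly_mapping_eqI) (simp add: lookup_fstar lookup_add)

lemma fstar_fstar [simp]: "fstar (fstar a) = a"
  by (rule poly_mapping_eqI) (simp add: lookup_fstar)

lemma fstar_fscale: "fstar (fscale c a) = fscale (cnj c) (fstar a)"
  by (rule poly_mapping_eqI) (simp add: lookup_fstar lookup_fscale)

lemma fstar_single: "fstar (Poly_Mapping.single w c) = Poly_Mapping.single (rev w) (cnj c)"
  by (rule poly_mapping_eqI) (auto simp: lookup_fstar lookup_single when_def)

lemma fstar_gen [simp]: "fstar (gen g) = gen g"
  by (simp add: gen_def fstar_single)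

lemma fstar_0 [simp]: "fstar 0 = 0"
  by (rule poly_mapping_eqI) (simp add: lookup_fstar)

lemma falg_induct [case_names zero single add]:
  assumes "P 0" "\<And>w c. P (Poly_Mapping.single w c)" "\<And>a b. P a \<Longrightarrow> P b \<Longrightarrow> P (a + b)"
  shows "P (a :: 'g falg)"
proof (induction a rule: update_induct)
  case const then show ?case by (fact assms(1))
next
  case (update f a b)
  have "Poly_Mapping.update a b f = f + Poly_Mapping.single a b"
    using update by (intro poly_mapping_eqI)
     (auto simp: lookup_update lookup_add lookup_single when_def in_keys_iff)
  then show ?case using assms update by metis
qed

lemma fscale_mult_right: "a * fscale c b = fscale c (a * b)"
proof (induction a rule: falg_induct)
  case (single w d)
  show ?case by (simp add: fscale_single_mult mult_single mult.assoc[symmetric] mult.commute)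
     (simp add: zero_list_def plus_list_def)?
qed (simp_all add: distrib_right fscale_add, simp add: fscale_single_mult)

lemma fstar_mult: "fstar (a * b) = fstar b * fstar a"
proof (induction a rule: falg_induct)
  case (single w c)
  show ?case
  proof (induction b rule: falg_induct)
    case (single v d)
    show ?case by (simp add: mult_single fstar_single plus_list_def mult.commute)
  qed (simp_all add: distrib_left distrib_right fstar_add)
qed (simp_all add: distrib_left distrib_right fstar_add)

lemma fstar_1 [simp]: "fstar 1 = 1"
  by (simp add: fstar_single zero_list_def flip: single_one)

lemma gen_word: "Poly_Mapping.single w c = fscale c (prod_list (map gen w))"
proof (induction w)
  case Nil
  show ?case by (simp add: fscale_single_mult zero_list_def)
next
  case (Cons g w)
  have "Poly_Mapping.single (g # w) c = gen g * Poly_Mapping.single w c"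
    by (simp add: gen_def mult_single plus_list_def)
  then show ?case by (simp add: Cons fscale_mult_right)
qed


lemma fscale_uminus: "fscale (- 1) a = - a"
  by (rule poly_mapping_eqI) (simp add: lookup_fscale)

lemma fscale_diff: "fscale c (a - b) = fscale c a - fscale c b"
  by (simp add: fscale_single_mult right_diff_distrib)

lemma fstar_diff: "fstar (a - b) = fstar a - fstar b"
  by (rule poly_mapping_eqI) (simp add: lookup_fstar lookup_minus)

subsection \<open>The completion is a C*-algebra\<close>

locale cs_seminorm =
  fixes p :: "'g falg \<Rightarrow> real"
  assumes cs: "cstar_seminorm p"
begin

lemma p_add: "p (a + b) \<le> p a + p b" and p_scale: "p (fscale c a) = cmod c * p a"
  and p_mult: "p (a * b) \<le> p a * p b" and p_star: "p (fstar a * a) = (p a)\<^sup>2"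
  using cs unfolding cstar_seminorm_def by auto

lemma p_0 [simp]: "p 0 = 0"
  using p_scale[of 0 0] by (simp add: fscale_single_mult)

lemma p_minus [simp]: "p (- a) = p a"
  using p_scale[of "-1" a] by (simp add: fscale_uminus)

lemma p_nonneg [simp]: "0 \<le> p a"
  using p_add[of a "- a"] by simp

lemma p_diff: "p (a - b) \<le> p a + p b"
  using p_add[of a "- b"] by simp

lemma p_swap: "p (a - b) = p (b - a)"
  using p_minus[of "a - b"] by simp

lemma p_tri: "p (a - c) \<le> p (a - b) + p (b - c)"
  using p_add[of "a - b" "b - c"] by simp

lemma p_fstar [simp]: "p (fstar a) = p a"
proof -
  have *: "p a \<le> p (fstar a)" for a
  proof (cases "p a = 0")
    case False
    then have "0 < p a" using p_nonneg[of a] by linarith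
    moreover have "p a * p a \<le> p (fstar a) * p a"
      using p_mult[of "fstar a" a] p_star[of a] by (simp add: power2_eq_square)
    ultimately show ?thesis by simp
  qed simp
  from *[of a] *[of "fstar a"] show ?thesis by simp
qed

lemma p_absdiff: "\<bar>p a - p b\<bar> \<le> p (a - b)"
  using p_add[of "a - b" b] p_add[of "b - a" a] p_swap[of a b] by simp

definition eqv :: "(nat \<Rightarrow> 'g falg) \<Rightarrow> (nat \<Rightarrow> 'g falg) \<Rightarrow> bool" where
  "eqv X Y \<longleftrightarrow> (\<lambda>n. p (X n - Y n)) \<longlonglongrightarrow> 0"

lemma eqv_refl [simp]: "eqv X X" by (simp add: eqv_def)

lemma eqv_sym: "eqv X Y \<Longrightarrow> eqv Y X"
  by (simp add: eqv_def p_swap)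

lemma eqv_trans: assumes "eqv X Y" "eqv Y Z" shows "eqv X Z"
  unfolding eqv_def
proof (rule tendsto_sandwich[OF _ _ tendsto_const])
  show "(\<lambda>n. p (X n - Y n) + p (Y n - Z n)) \<longlonglongrightarrow> 0"
    using tendsto_add[OF assms[unfolded eqv_def]] by simp
qed (auto intro: always_eventually p_tri)

lemma cauI: "(\<And>e. e > 0 \<Longrightarrow> \<exists>M. \<forall>m\<ge>M. \<forall>n\<ge>M. p (X m - X n) < e) \<Longrightarrow> X \<in> cauchy_seqs p"
  by (auto simp: cauchy_seqs_def)

lemma cauD: "X \<in> cauchy_seqs p \<Longrightarrow> e > 0 \<Longrightarrow> \<exists>M. \<forall>m\<ge>M. \<forall>n\<ge>M. p (X m - X n) < e"
  by (auto simp: cauchy_seqs_def)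

lemma cau_const [simp]: "(\<lambda>n. a) \<in> cauchy_seqs p"
  by (auto intro: cauI)

lemma cau_lip:
  assumes "X \<in> cauchy_seqs p" "K > 0" "\<And>m n. p (Y m - Y n) \<le> K * p (X m - X n)"
  shows "Y \<in> cauchy_seqs p"
proof (rule cauI)
  fix e :: real assume "e > 0"
  then obtain M where "\<forall>m\<ge>M. \<forall>n\<ge>M. p (X m - X n) < e / K"
    using cauD[OF assms(1), of "e / K"] \<open>K > 0\<close> by auto
  then have "\<forall>m\<ge>M. \<forall>n\<ge>M. K * p (X m - X n) < e"
    using \<open>K > 0\<close> by (simp add: pos_less_divide_eq mult.commute)
  then show "\<exists>M. \<forall>m\<ge>M. \<forall>n\<ge>M. p (Y m - Y n) < e"
    using assms(3) by (meson order.strict_trans1)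
qed

lemma cau_lip2:
  assumes "X \<in> cauchy_seqs p" "Y \<in> cauchy_seqs p" "K > 0"
    "\<And>m n. p (Z m - Z n) \<le> K * p (X m - X n) + K * p (Y m - Y n)"
  shows "Z \<in> cauchy_seqs p"
proof (rule cauI)
  fix e :: real assume "e > 0"
  then have e: "e / (2 * K) > 0" using \<open>K > 0\<close> by simp
  obtain M1 where 1: "\<forall>m\<ge>M1. \<forall>n\<ge>M1. p (X m - X n) < e / (2 * K)"
    using cauD[OF assms(1) e] by auto
  obtain M2 where 2: "\<forall>m\<ge>M2. \<forall>n\<ge>M2. p (Y m - Y n) < e / (2 * K)"
    using cauD[OF assms(2) e] by auto
  have "p (Z m - Z n) < e" if "m \<ge> max M1 M2" "n \<ge> max M1 M2" for m n
  proof -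
    have "K * p (X m - X n) < e / 2" "K * p (Y m - Y n) < e / 2"
      using that 1 2 \<open>K > 0\<close> by (auto simp: field_simps)
    then show ?thesis using assms(4)[of m n] by linarith
  qed
  then show "\<exists>M. \<forall>m\<ge>M. \<forall>n\<ge>M. p (Z m - Z n) < e" by blast
qed

lemma cau_add: "X \<in> cauchy_seqs p \<Longrightarrow> Y \<in> cauchy_seqs p \<Longrightarrow> (\<lambda>n. X n + Y n) \<in> cauchy_seqs p"
  by (rule cau_lip2[of X Y 1]) (auto simp: add_diff_add intro: p_add)

lemma cau_uminus: "X \<in> cauchy_seqs p \<Longrightarrow> (\<lambda>n. - X n) \<in> cauchy_seqs p"
  by (rule cau_lip[where K = 1]) (auto simp: p_swap)

lemma cau_fstar: "X \<in> cauchy_seqs p \<Longrightarrow> (\<lambda>n. fstar (X n)) \<in> cauchy_seqs p"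
  by (rule cau_lip[where K = 1]) (auto simp: fstar_diff[symmetric])

lemma cau_fscale: "X \<in> cauchy_seqs p \<Longrightarrow> (\<lambda>n. fscale c (X n)) \<in> cauchy_seqs p"
  by (rule cau_lip[where K = "cmod c + 1"])
     (auto simp: fscale_diff[symmetric] p_scale add_nonneg_pos intro: mult_right_mono)

lemma cau_bounded:
  assumes "X \<in> cauchy_seqs p" shows "\<exists>K>0. \<forall>n. p (X n) \<le> K"
proof -
  obtain M where M: "\<forall>m\<ge>M. \<forall>n\<ge>M. p (X m - X n) < 1" using cauD[OF assms, of 1] by auto
  have "p (X n) \<le> Max ((\<lambda>n. p (X n)) ` {..M}) + 1" (is "_ \<le> ?K + 1") for n
  proof (cases "n \<le> M")
    case True
    then have "p (X n) \<le> ?K" by (intro Max_ge) auto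
    then show ?thesis by simp
  next
    case False
    have "p (X M) \<le> ?K" by (intro Max_ge) auto
    moreover have "p (X n - X M) < 1" using M False by auto
    ultimately show ?thesis using p_absdiff[of "X n" "X M"] by linarith
  qed
  moreover have "?K \<ge> 0" using p_nonneg[of "X 0"]
    by (meson Max_ge atMost_iff finite_atMost finite_imageI imageI le0 order_trans)
  ultimately show ?thesis by (intro exI[of _ "?K + 1"]) auto
qed

lemma p_mult_diff: "p (a * b - c * d) \<le> p (a - c) * p b + p c * p (b - d)"
proof -
  have "a * b - c * d = (a - c) * b + c * (b - d)" by (simp add: algebra_simps)
  then show ?thesis
    using p_add[of "(a - c) * b" "c * (b - d)"] p_mult[of "a - c" b] p_mult[of c "b - d"] by simp
qed

lemma cau_mult:
  assumes "X \<in> cauchy_seqs p" "Y \<in> cauchy_seqs p" shows "(\<lambda>n. X n * Y n) \<in> cauchy_seqs p"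
proof -
  obtain K L where K: "K > 0" "\<And>n. p (X n) \<le> K" and L: "L > 0" "\<And>n. p (Y n) \<le> L"
    using cau_bounded assms by meson
  show ?thesis
  proof (rule cau_lip2[OF assms, where K = "K + L"])
    fix m n
    have "p (X m - X n) * p (Y m) \<le> p (X m - X n) * (K + L)"
      using L(2)[of m] K(1) by (intro mult_left_mono) auto
    moreover have "p (X n) * p (Y m - Y n) \<le> (K + L) * p (Y m - Y n)"
      using K(2)[of n] L(1) by (intro mult_right_mono) auto
    ultimately show "p (X m * Y m - X n * Y n) \<le> (K + L) * p (X m - X n) + (K + L) * p (Y m - Y n)"
      using p_mult_diff[of "X m" "Y m" "X n" "Y n"] by (simp add: mult.commute)
  qed (use K L in auto)
qed

lemma eqv_add: assumes "eqv X X'" "eqv Y Y'" shows "eqv (\<lambda>n. X n + Y n) (\<lambda>n. X' n + Y' n)"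
  unfolding eqv_def
proof (rule tendsto_sandwich[OF _ _ tendsto_const])
  show "(\<lambda>n. p (X n - X' n) + p (Y n - Y' n)) \<longlonglongrightarrow> 0"
    using tendsto_add[OF assms[unfolded eqv_def]] by simp
qed (auto intro: always_eventually p_add simp: add_diff_add)

lemma eqv_fstar: "eqv X Y \<Longrightarrow> eqv (\<lambda>n. fstar (X n)) (\<lambda>n. fstar (Y n))"
  by (simp add: eqv_def fstar_diff[symmetric])

lemma eqv_fscale: "eqv X Y \<Longrightarrow> eqv (\<lambda>n. fscale c (X n)) (\<lambda>n. fscale c (Y n))"
  unfolding eqv_def fscale_diff[symmetric] p_scale by (rule tendsto_mult_right_zero)

lemma eqv_mult:
  assumes "eqv X X'" "eqv Y Y'" "X' \<in> cauchy_seqs p" "Y \<in> cauchy_seqs p"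
  shows "eqv (\<lambda>n. X n * Y n) (\<lambda>n. X' n * Y' n)"
  unfolding eqv_def
proof -
  obtain K L where K: "K > 0" "\<And>n. p (X' n) \<le> K" and L: "L > 0" "\<And>n. p (Y n) \<le> L"
    using cau_bounded assms by meson
  show "(\<lambda>n. p (X n * Y n - X' n * Y' n)) \<longlonglongrightarrow> 0"
  proof (rule tendsto_sandwich[OF _ _ tendsto_const])
    have "(\<lambda>n. p (X n - X' n) * L + K * p (Y n - Y' n)) \<longlonglongrightarrow> 0 * L + K * 0"
      using assms(1,2)[unfolded eqv_def] by (intro tendsto_intros)
    then show "(\<lambda>n. p (X n - X' n) * L + K * p (Y n - Y' n)) \<longlonglongrightarrow> 0" by simp
    show "\<forall>\<^sub>F n in sequentially. p (X n * Y n - X' n * Y' n) \<le> p (X n - X' n) * L + K * p (Y n - Y' n)"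
      by (intro always_eventually allI order_trans[OF p_mult_diff] add_mono mult_mono K L)
         (use K L in \<open>auto intro: less_imp_le\<close>)
  qed auto
qed

lemma eqv_cau: assumes "eqv X Y" "X \<in> cauchy_seqs p" shows "Y \<in> cauchy_seqs p"
proof (rule cauI)
  fix e :: real assume "e > 0"
  then have e: "e / 3 > 0" by simp
  obtain M1 where 1: "\<forall>m\<ge>M1. \<forall>n\<ge>M1. p (X m - X n) < e / 3" using cauD[OF assms(2) e] by auto
  obtain M2 where 2: "\<forall>n\<ge>M2. p (X n - Y n) < e / 3"
    using LIMSEQ_D[OF assms(1)[unfolded eqv_def] e] by auto
  have "p (Y m - Y n) < e" if "m \<ge> max M1 M2" "n \<ge> max M1 M2" for m n
    using that 1[rule_format, of m n] 2[rule_format, of m] 2[rule_format, of n]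
      p_tri[of "Y m" "Y n" "X m"] p_tri[of "X m" "Y n" "X n"] p_swap[of "Y m" "X m"] by auto
  then show "\<exists>M. \<forall>m\<ge>M. \<forall>n\<ge>M. p (Y m - Y n) < e" by blast
qed

lemma seq_class_eq:
  assumes "X \<in> cauchy_seqs p" "Y \<in> cauchy_seqs p"
  shows "seq_class p X = seq_class p Y \<longleftrightarrow> eqv X Y"
proof
  assume "seq_class p X = seq_class p Y"
  moreover have "Y \<in> seq_class p Y" using assms by (simp add: seq_class_def)
  ultimately have "Y \<in> seq_class p X" by simp
  then show "eqv X Y" by (simp add: seq_class_def eqv_def)
next
  assume "eqv X Y"
  then show "seq_class p X = seq_class p Y"
    unfolding seq_class_def eqv_def[symmetric] using eqv_trans eqv_sym by blast
qed

lemma rep_seq_class: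
  assumes "X \<in> cauchy_seqs p"
  shows "rep (seq_class p X) \<in> cauchy_seqs p" "eqv (rep (seq_class p X)) X"
proof -
  have "X \<in> seq_class p X" using assms by (simp add: seq_class_def)
  then have "rep (seq_class p X) \<in> seq_class p X" unfolding rep_def by (rule someI[of "\<lambda>Y. Y \<in> seq_class p X"])
  then show "rep (seq_class p X) \<in> cauchy_seqs p" "eqv (rep (seq_class p X)) X"
    by (auto simp: seq_class_def eqv_def[symmetric] intro: eqv_sym)
qed

lemma p_convergent: assumes "X \<in> cauchy_seqs p" shows "convergent (\<lambda>n. p (X n))"
proof (rule real_Cauchy_convergent, rule CauchyI)
  fix e :: real assume "e > 0"
  then obtain M where "\<forall>m\<ge>M. \<forall>n\<ge>M. p (X m - X n) < e" using cauD[OF assms] by blast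
  then show "\<exists>M. \<forall>m\<ge>M. \<forall>n\<ge>M. norm (p (X m) - p (X n)) < e"
    using p_absdiff by (metis real_norm_def order.strict_trans1)
qed

lemma p_lim: "X \<in> cauchy_seqs p \<Longrightarrow> (\<lambda>n. p (X n)) \<longlonglongrightarrow> lim (\<lambda>n. p (X n))"
  using p_convergent convergent_LIMSEQ_iff by blast

lemma eqv_lim: assumes "eqv X Y" "X \<in> cauchy_seqs p" shows "lim (\<lambda>n. p (X n)) = lim (\<lambda>n. p (Y n))"
proof -
  have "(\<lambda>n. p (X n) - p (Y n)) \<longlonglongrightarrow> 0"
    by (rule tendsto_rabs_zero_cancel, rule tendsto_sandwich[OF _ _ tendsto_const assms(1)[unfolded eqv_def]])
       (simp_all add: p_absdiff)
  from tendsto_diff[OF p_lim[OF assms(2)] this]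
  have "(\<lambda>n. p (Y n)) \<longlonglongrightarrow> lim (\<lambda>n. p (X n))" by simp
  then show ?thesis by (simp add: limI)
qed

abbreviation "K \<equiv> completion p"

lemma carrier_completion: "carrier K = seq_class p ` cauchy_seqs p"
  and one_completion: "\<one>\<^bsub>K\<^esub> = seq_class p (\<lambda>n. 1)"
  and zero_completion: "\<zero>\<^bsub>K\<^esub> = seq_class p (\<lambda>n. 0)"
  by (simp_all add: completion_def)

lemma completion_ops:
  assumes X: "X \<in> cauchy_seqs p"
  shows smult_completion: "c \<odot>\<^bsub>K\<^esub> seq_class p X = seq_class p (\<lambda>n. fscale c (X n))"
    and star_completion: "star K (seq_class p X) = seq_class p (\<lambda>n. fstar (X n))"
    and cnorm_completion: "cnorm K (seq_class p X) = lim (\<lambda>n. p (X n))"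
proof -
  note r = rep_seq_class[OF X]
  show "c \<odot>\<^bsub>K\<^esub> seq_class p X = seq_class p (\<lambda>n. fscale c (X n))"
    by (simp add: completion_def seq_class_eq cau_fscale r X eqv_fscale)
  show "star K (seq_class p X) = seq_class p (\<lambda>n. fstar (X n))"
    by (simp add: completion_def seq_class_eq cau_fstar r X eqv_fstar)
  show "cnorm K (seq_class p X) = lim (\<lambda>n. p (X n))"
    by (simp add: completion_def eqv_lim r)
qed

lemma completion_ops2:
  assumes X: "X \<in> cauchy_seqs p" and Y: "Y \<in> cauchy_seqs p"
  shows add_completion: "seq_class p X \<oplus>\<^bsub>K\<^esub> seq_class p Y = seq_class p (\<lambda>n. X n + Y n)"
    and mult_completion: "seq_class p X \<otimes>\<^bsub>K\<^esub> seq_class p Y = seq_class p (\<lambda>n. X n * Y n)"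
  using rep_seq_class[OF X] rep_seq_class[OF Y] X Y
  by (simp_all add: completion_def seq_class_eq cau_add cau_mult eqv_add eqv_mult)

lemmas completion_simps = one_completion zero_completion completion_ops completion_ops2
  cau_add cau_mult cau_fstar cau_fscale

lemma ring_completion: "ring K"
proof -
  have "abelian_group K"
  proof (rule abelian_groupI)
    show "\<zero>\<^bsub>K\<^esub> \<in> carrier K" by (simp add: carrier_completion completion_simps)
    fix x assume "x \<in> carrier K"
    then obtain X where X: "X \<in> cauchy_seqs p" "x = seq_class p X" by (auto simp: carrier_completion)
    show "\<zero>\<^bsub>K\<^esub> \<oplus>\<^bsub>K\<^esub> x = x" using X by (simp add: completion_simps)
    have "seq_class p (\<lambda>n. - X n) \<oplus>\<^bsub>K\<^esub> x = \<zero>\<^bsub>K\<^esub>"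
      using X by (simp add: completion_simps cau_uminus)
    then show "\<exists>y\<in>carrier K. y \<oplus>\<^bsub>K\<^esub> x = \<zero>\<^bsub>K\<^esub>"
      using cau_uminus[OF X(1)] by (auto simp: carrier_completion)
    fix y assume "y \<in> carrier K"
    then obtain Y where Y: "Y \<in> cauchy_seqs p" "y = seq_class p Y" by (auto simp: carrier_completion)
    show "x \<oplus>\<^bsub>K\<^esub> y \<in> carrier K" using X Y by (simp add: carrier_completion completion_simps)
    show "x \<oplus>\<^bsub>K\<^esub> y = y \<oplus>\<^bsub>K\<^esub> x" using X Y by (simp add: completion_simps add.commute)
    fix z assume "z \<in> carrier K"
    then obtain Z where "Z \<in> cauchy_seqs p" "z = seq_class p Z" by (auto simp: carrier_completion)
    then show "x \<oplus>\<^bsub>K\<^esub> y \<oplus>\<^bsub>K\<^esub> z = x \<oplus>\<^bsub>K\<^esub> (y \<oplus>\<^bsub>K\<^esub> z)"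
      using X Y by (simp add: completion_simps add.assoc)
  qed
  moreover have "monoid K"
  proof (rule monoidI)
    show "\<one>\<^bsub>K\<^esub> \<in> carrier K" by (simp add: carrier_completion completion_simps)
    fix x assume "x \<in> carrier K"
    then obtain X where X: "X \<in> cauchy_seqs p" "x = seq_class p X" by (auto simp: carrier_completion)
    show "\<one>\<^bsub>K\<^esub> \<otimes>\<^bsub>K\<^esub> x = x" "x \<otimes>\<^bsub>K\<^esub> \<one>\<^bsub>K\<^esub> = x" using X by (simp_all add: completion_simps)
    fix y assume "y \<in> carrier K"
    then obtain Y where Y: "Y \<in> cauchy_seqs p" "y = seq_class p Y" by (auto simp: carrier_completion)
    show "x \<otimes>\<^bsub>K\<^esub> y \<in> carrier K" using X Y by (simp add: carrier_completion completion_simps)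
    fix z assume "z \<in> carrier K"
    then obtain Z where "Z \<in> cauchy_seqs p" "z = seq_class p Z" by (auto simp: carrier_completion)
    then show "x \<otimes>\<^bsub>K\<^esub> y \<otimes>\<^bsub>K\<^esub> z = x \<otimes>\<^bsub>K\<^esub> (y \<otimes>\<^bsub>K\<^esub> z)"
      using X Y by (simp add: completion_simps mult.assoc)
  qed
  moreover have "ring_axioms K"
  proof (rule ring_axioms.intro)
    fix x y z assume "x \<in> carrier K" "y \<in> carrier K" "z \<in> carrier K"
    then obtain X Y Z where "X \<in> cauchy_seqs p" "x = seq_class p X"
      "Y \<in> cauchy_seqs p" "y = seq_class p Y" "Z \<in> cauchy_seqs p" "z = seq_class p Z"
      by (auto simp: carrier_completion)
    then show "(x \<oplus>\<^bsub>K\<^esub> y) \<otimes>\<^bsub>K\<^esub> z = x \<otimes>\<^bsub>K\<^esub> z \<oplus>\<^bsub>K\<^esub> y \<otimes>\<^bsub>K\<^esub> z"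
      and "z \<otimes>\<^bsub>K\<^esub> (x \<oplus>\<^bsub>K\<^esub> y) = z \<otimes>\<^bsub>K\<^esub> x \<oplus>\<^bsub>K\<^esub> z \<otimes>\<^bsub>K\<^esub> y"
      by (simp_all add: completion_simps distrib_left distrib_right)
  qed
  ultimately show ?thesis by (rule ring.intro)
qed

interpretation K: ring K by (rule ring_completion)

lemma cau_diff: "X \<in> cauchy_seqs p \<Longrightarrow> Y \<in> cauchy_seqs p \<Longrightarrow> (\<lambda>n. X n - Y n) \<in> cauchy_seqs p"
  using cau_add[OF _ cau_uminus[of Y], of X] by simp

lemma minus_completion:
  assumes X: "X \<in> cauchy_seqs p" and Y: "Y \<in> cauchy_seqs p"
  shows "seq_class p X \<ominus>\<^bsub>K\<^esub> seq_class p Y = seq_class p (\<lambda>n. X n - Y n)"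
proof -
  have "seq_class p (\<lambda>n. - Y n) \<oplus>\<^bsub>K\<^esub> seq_class p Y = \<zero>\<^bsub>K\<^esub>"
    using Y by (simp add: completion_simps cau_uminus)
  then have "\<ominus>\<^bsub>K\<^esub> seq_class p Y = seq_class p (\<lambda>n. - Y n)"
    using Y by (intro K.minus_equality) (auto simp: carrier_completion cau_uminus)
  then show ?thesis
    using X Y add_completion[OF X cau_uminus[OF Y]] by (simp add: a_minus_def)
qed

lemma approx_const:
  assumes X: "X \<in> cauchy_seqs p" and "e > 0"
  shows "\<exists>M. \<forall>m\<ge>M. cnorm K (seq_class p X \<ominus>\<^bsub>K\<^esub> seq_class p (\<lambda>n. X m)) < e"
proof -
  obtain M where M: "\<forall>m\<ge>M. \<forall>n\<ge>M. p (X m - X n) < e / 2"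
    using cauD[OF X, of "e / 2"] \<open>e > 0\<close> by auto
  have "cnorm K (seq_class p X \<ominus>\<^bsub>K\<^esub> seq_class p (\<lambda>n. X m)) < e" if "m \<ge> M" for m
  proof -
    have "lim (\<lambda>n. p (X n - X m)) \<le> e / 2"
      by (rule LIMSEQ_le_const2[OF p_lim[OF cau_diff[OF X cau_const]]])
         (use M that in \<open>auto intro!: exI[of _ M] less_imp_le\<close>)
    then show ?thesis
      using \<open>e > 0\<close> X by (simp add: minus_completion completion_simps cau_diff)
  qed
  then show ?thesis by blast
qed

lemma cnorm_const: "cnorm K (seq_class p (\<lambda>n. a)) = p a"
  by (simp add: completion_simps limI)

lemma completion_triangle:
  assumes "x \<in> carrier K" "y \<in> carrier K" shows "cnorm K (x \<oplus>\<^bsub>K\<^esub> y) \<le> cnorm K x + cnorm K y"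
proof -
  obtain X Y where X: "X \<in> cauchy_seqs p" "x = seq_class p X" and Y: "Y \<in> cauchy_seqs p" "y = seq_class p Y"
    using assms by (auto simp: carrier_completion)
  have "lim (\<lambda>n. p (X n + Y n)) \<le> lim (\<lambda>n. p (X n)) + lim (\<lambda>n. p (Y n))"
    by (rule LIMSEQ_le[OF p_lim tendsto_add[OF p_lim p_lim]])
       (use X Y in \<open>auto intro: p_add cau_add\<close>)
  then show ?thesis using X Y by (simp add: completion_simps)
qed

lemma completion_mult:
  assumes "x \<in> carrier K" "y \<in> carrier K" shows "cnorm K (x \<otimes>\<^bsub>K\<^esub> y) \<le> cnorm K x * cnorm K y"
proof -
  obtain X Y where X: "X \<in> cauchy_seqs p" "x = seq_class p X" and Y: "Y \<in> cauchy_seqs p" "y = seq_class p Y"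
    using assms by (auto simp: carrier_completion)
  have "lim (\<lambda>n. p (X n * Y n)) \<le> lim (\<lambda>n. p (X n)) * lim (\<lambda>n. p (Y n))"
    by (rule LIMSEQ_le[OF p_lim tendsto_mult[OF p_lim p_lim]])
       (use X Y in \<open>auto intro: p_mult cau_mult\<close>)
  then show ?thesis using X Y by (simp add: completion_simps)
qed

lemma completion_complete:
  assumes Z: "\<And>n. Z n \<in> carrier K"
    and C: "\<And>e. e > 0 \<Longrightarrow> \<exists>M. \<forall>m\<ge>M. \<forall>n\<ge>M. cnorm K (Z m \<ominus>\<^bsub>K\<^esub> Z n) < e"
  shows "\<exists>l\<in>carrier K. (\<lambda>n. cnorm K (Z n \<ominus>\<^bsub>K\<^esub> l)) \<longlonglongrightarrow> 0"
proof -
  have tri: "cnorm K (x \<ominus>\<^bsub>K\<^esub> z) \<le> cnorm K (x \<ominus>\<^bsub>K\<^esub> y) + cnorm K (y \<ominus>\<^bsub>K\<^esub> z)"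
    and swap: "cnorm K (x \<ominus>\<^bsub>K\<^esub> y) = cnorm K (y \<ominus>\<^bsub>K\<^esub> x)"
    if c: "x \<in> carrier K" "y \<in> carrier K" "z \<in> carrier K" for x y z
  proof -
    obtain X Y Z where "X \<in> cauchy_seqs p" "x = seq_class p X" "Y \<in> cauchy_seqs p" "y = seq_class p Y"
       "Z \<in> cauchy_seqs p" "z = seq_class p Z"
      using c by (auto simp: carrier_completion)
    then have "x \<ominus>\<^bsub>K\<^esub> z = (x \<ominus>\<^bsub>K\<^esub> y) \<oplus>\<^bsub>K\<^esub> (y \<ominus>\<^bsub>K\<^esub> z)"
      and s: "cnorm K (x \<ominus>\<^bsub>K\<^esub> y) = cnorm K (y \<ominus>\<^bsub>K\<^esub> x)"
      by (simp_all add: completion_simps minus_completion cau_diff p_swap[of "X n" "Y n" for n])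
    then show "cnorm K (x \<ominus>\<^bsub>K\<^esub> z) \<le> cnorm K (x \<ominus>\<^bsub>K\<^esub> y) + cnorm K (y \<ominus>\<^bsub>K\<^esub> z)"
      using c completion_triangle[OF K.minus_closed K.minus_closed] by metis
    show "cnorm K (x \<ominus>\<^bsub>K\<^esub> y) = cnorm K (y \<ominus>\<^bsub>K\<^esub> x)" by (fact s)
  qed
  let ?c = "\<lambda>a. seq_class p (\<lambda>n. a)"
  have cc: "?c a \<in> carrier K" for a by (auto simp: carrier_completion)
  have "\<exists>a. cnorm K (Z k \<ominus>\<^bsub>K\<^esub> ?c a) < 1 / (real k + 1)" for k
  proof -
    obtain X where X: "X \<in> cauchy_seqs p" "Z k = seq_class p X"
      using Z by (auto simp: carrier_completion)
    show ?thesis using approx_const[OF X(1), of "1 / (real k + 1)"] X(2) by auto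
  qed
  then obtain W where W: "\<And>k. cnorm K (Z k \<ominus>\<^bsub>K\<^esub> ?c (W k)) < 1 / (real k + 1)" by metis
  have small: "\<exists>M. \<forall>k\<ge>M. 1 / (real k + 1) < e" if "e > 0" for e :: real
  proof -
    have "(\<lambda>k. 1 / (real k + 1)) \<longlonglongrightarrow> 0"
      using LIMSEQ_Suc[OF lim_1_over_n] by (simp add: add.commute)
    from LIMSEQ_D[OF this that] show ?thesis by auto
  qed
  have cW: "W \<in> cauchy_seqs p"
  proof (rule cauI)
    fix e :: real assume "e > 0"
    then have e: "e / 3 > 0" by simp
    obtain M1 where 1: "\<forall>m\<ge>M1. \<forall>n\<ge>M1. cnorm K (Z m \<ominus>\<^bsub>K\<^esub> Z n) < e / 3" using C[OF e] by auto
    obtain M2 where 2: "\<forall>k\<ge>M2. 1 / (real k + 1) < e / 3" using small[OF e] by auto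
    have "p (W m - W n) < e" if "m \<ge> max M1 M2" "n \<ge> max M1 M2" for m n
    proof -
      have "p (W m - W n) = cnorm K (?c (W m) \<ominus>\<^bsub>K\<^esub> ?c (W n))"
        by (simp add: minus_completion cnorm_const)
      also have "\<dots> \<le> cnorm K (?c (W m) \<ominus>\<^bsub>K\<^esub> Z m) + (cnorm K (Z m \<ominus>\<^bsub>K\<^esub> Z n) + cnorm K (Z n \<ominus>\<^bsub>K\<^esub> ?c (W n)))"
        using tri[of "?c (W m)" "Z m" "?c (W n)", OF cc Z cc] tri[of "Z m" "Z n" "?c (W n)", OF Z Z cc] by linarith
      also have "cnorm K (?c (W m) \<ominus>\<^bsub>K\<^esub> Z m) < e / 3"
        using 2[rule_format, of m] W[of m] that swap[of "?c (W m)" "Z m" "Z m", OF cc Z Z] by auto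
      also have "cnorm K (Z m \<ominus>\<^bsub>K\<^esub> Z n) < e / 3" using 1 that by auto
      also have "cnorm K (Z n \<ominus>\<^bsub>K\<^esub> ?c (W n)) < e / 3"
        using 2[rule_format, of n] W[of n] that by auto
      finally show ?thesis by simp
    qed
    then show "\<exists>M. \<forall>m\<ge>M. \<forall>n\<ge>M. p (W m - W n) < e" by blast
  qed
  let ?l = "seq_class p W"
  have l: "?l \<in> carrier K" using cW by (auto simp: carrier_completion)
  have "(\<lambda>n. cnorm K (Z n \<ominus>\<^bsub>K\<^esub> ?l)) \<longlonglongrightarrow> 0"
  proof (rule LIMSEQ_I)
    fix e :: real assume "e > 0"
    then have e: "e / 2 > 0" by simp
    obtain M1 where 1: "\<forall>m\<ge>M1. cnorm K (?l \<ominus>\<^bsub>K\<^esub> ?c (W m)) < e / 2" using approx_const[OF cW e] by auto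
    obtain M2 where 2: "\<forall>k\<ge>M2. 1 / (real k + 1) < e / 2" using small[OF e] by auto
    have "norm (cnorm K (Z n \<ominus>\<^bsub>K\<^esub> ?l) - 0) < e" if "n \<ge> max M1 M2" for n
    proof -
      have "cnorm K (Z n \<ominus>\<^bsub>K\<^esub> ?l) \<le> cnorm K (Z n \<ominus>\<^bsub>K\<^esub> ?c (W n)) + cnorm K (?c (W n) \<ominus>\<^bsub>K\<^esub> ?l)"
        using tri[OF Z cc l] .
      also have "\<dots> < e"
        using W[of n] 2[rule_format, of n] 1[rule_format, of n] that swap[of "?c (W n)" ?l ?l, OF cc l l] by auto
      finally have "cnorm K (Z n \<ominus>\<^bsub>K\<^esub> ?l) < e" .
      moreover have "0 \<le> cnorm K (Z n \<ominus>\<^bsub>K\<^esub> ?l)"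
      proof -
        obtain X where X: "X \<in> cauchy_seqs p" "Z n \<ominus>\<^bsub>K\<^esub> ?l = seq_class p X"
          using K.minus_closed[OF Z l] unfolding carrier_completion by (metis imageE)
        show ?thesis unfolding X(2) cnorm_completion[OF X(1)]
          by (rule LIMSEQ_le_const[OF p_lim[OF X(1)]]) auto
      qed
      ultimately show ?thesis by simp
    qed
    then show "\<exists>M. \<forall>n\<ge>M. norm (cnorm K (Z n \<ominus>\<^bsub>K\<^esub> ?l) - 0) < e" by blast
  qed
  with l show ?thesis by blast
qed

lemma lim_mult_const: "X \<in> cauchy_seqs p \<Longrightarrow> lim (\<lambda>n. r * p (X n)) = r * lim (\<lambda>n. p (X n))"
  by (intro limI tendsto_mult tendsto_const p_lim)

lemma lim_power: "X \<in> cauchy_seqs p \<Longrightarrow> lim (\<lambda>n. (p (X n))\<^sup>2) = (lim (\<lambda>n. p (X n)))\<^sup>2"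
  by (intro limI tendsto_power p_lim)

lemma cnorm_eq_zero_completion:
  assumes "x \<in> carrier K" "cnorm K x = 0" shows "x = \<zero>\<^bsub>K\<^esub>"
proof -
  obtain X where X: "X \<in> cauchy_seqs p" "x = seq_class p X" using assms by (auto simp: carrier_completion)
  then have "(\<lambda>n. p (X n)) \<longlonglongrightarrow> 0" using p_lim[OF X(1)] assms by (simp add: completion_simps)
  then show ?thesis using X by (simp add: zero_completion seq_class_eq eqv_def)
qed

lemma cstar_completion: "cstar_algebra K"
proof (intro cstar_algebra.intro ring_completion cstar_algebra_axioms.intro)
  fix x y c d
  assume "x \<in> carrier K"
  then obtain X where X: "X \<in> cauchy_seqs p" "x = seq_class p X" by (auto simp: carrier_completion)
  note s = completion_simps fscale_add fscale_add_left fscale_fscale carrier_completion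
        fscale_mult_left fscale_mult_right fstar_add fstar_fscale fstar_mult p_scale p_star
        lim_mult_const lim_power
  show "c \<odot>\<^bsub>K\<^esub> x \<in> carrier K" using X by (simp add: s)
  show "(c + d) \<odot>\<^bsub>K\<^esub> x = c \<odot>\<^bsub>K\<^esub> x \<oplus>\<^bsub>K\<^esub> d \<odot>\<^bsub>K\<^esub> x" using X by (simp add: s)
  show "(c * d) \<odot>\<^bsub>K\<^esub> x = c \<odot>\<^bsub>K\<^esub> (d \<odot>\<^bsub>K\<^esub> x)" using X by (simp add: s)
  show "1 \<odot>\<^bsub>K\<^esub> x = x" using X by (simp add: s)
  show "star K x \<in> carrier K" using X by (simp add: s)
  show "star K (star K x) = x" using X by (simp add: s)
  show "star K (c \<odot>\<^bsub>K\<^esub> x) = cnj c \<odot>\<^bsub>K\<^esub> star K x" using X by (simp add: s)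
  show "cnorm K (c \<odot>\<^bsub>K\<^esub> x) = cmod c * cnorm K x" using X by (simp add: s)
  show "cnorm K (star K x \<otimes>\<^bsub>K\<^esub> x) = (cnorm K x)\<^sup>2" using X by (simp add: s)
  show "cnorm K x = 0 \<Longrightarrow> x = \<zero>\<^bsub>K\<^esub>"
    using \<open>x \<in> carrier K\<close> by (rule cnorm_eq_zero_completion)
  assume "y \<in> carrier K"
  then obtain Y where Y: "Y \<in> cauchy_seqs p" "y = seq_class p Y" by (auto simp: carrier_completion)
  show "c \<odot>\<^bsub>K\<^esub> (x \<oplus>\<^bsub>K\<^esub> y) = c \<odot>\<^bsub>K\<^esub> x \<oplus>\<^bsub>K\<^esub> c \<odot>\<^bsub>K\<^esub> y" using X Y by (simp add: s)
  show "(c \<odot>\<^bsub>K\<^esub> x) \<otimes>\<^bsub>K\<^esub> y = c \<odot>\<^bsub>K\<^esub> (x \<otimes>\<^bsub>K\<^esub> y)" using X Y by (simp add: s)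
  show "x \<otimes>\<^bsub>K\<^esub> (c \<odot>\<^bsub>K\<^esub> y) = c \<odot>\<^bsub>K\<^esub> (x \<otimes>\<^bsub>K\<^esub> y)" using X Y by (simp add: s)
  show "star K (x \<oplus>\<^bsub>K\<^esub> y) = star K x \<oplus>\<^bsub>K\<^esub> star K y" using X Y by (simp add: s)
  show "star K (x \<otimes>\<^bsub>K\<^esub> y) = star K y \<otimes>\<^bsub>K\<^esub> star K x" using X Y by (simp add: s)
  show "cnorm K (x \<oplus>\<^bsub>K\<^esub> y) \<le> cnorm K x + cnorm K y"
    using \<open>x \<in> carrier K\<close> \<open>y \<in> carrier K\<close> by (rule completion_triangle)
  show "cnorm K (x \<otimes>\<^bsub>K\<^esub> y) \<le> cnorm K x * cnorm K y"
    using \<open>x \<in> carrier K\<close> \<open>y \<in> carrier K\<close> by (rule completion_mult)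
qed (rule completion_complete)

end

subsection \<open>The universal C*-seminorm\<close>

lemma cs_seminorm_le:
  assumes "cstar_seminorm p" "p (1 :: 'g falg) \<le> 1"
  shows "p (prod_list (map gen w)) \<le> prod_list (map (\<lambda>g. p (gen g)) w)"
proof (induction w)
  case (Cons g w)
  interpret cs_seminorm p using assms by unfold_locales
  show ?case using order_trans[OF p_mult mult_left_mono[OF Cons p_nonneg]] by simp
qed (use assms in simp)

lemma cstar_seminorm_one: assumes "cstar_seminorm p" shows "p 1 \<le> 1"
proof -
  interpret cs_seminorm p using assms by unfold_locales
  have "p 1 * p 1 = p 1" using p_star[of 1] by (simp add: power2_eq_square)
  then show ?thesis by auto
qed

lemma admissible_zero: "(\<lambda>a. 0) \<in> admissible R"
  by (simp add: admissible_def cstar_seminorm_def)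

lemma admissible_bdd:
  assumes "\<And>g. \<exists>C. \<forall>p\<in>admissible R. p (gen g) \<le> C"
  shows "\<exists>C. \<forall>p\<in>admissible R. p a \<le> C"
proof -
  obtain C where C: "\<And>g p. p \<in> admissible R \<Longrightarrow> p (gen g) \<le> C g" using assms by metis
  show ?thesis
  proof (induction a rule: falg_induct)
    case zero
    then show ?case by (auto simp: admissible_def cs_seminorm.p_0[OF cs_seminorm.intro])
  next
    case (single w c)
    have "p (Poly_Mapping.single w c) \<le> cmod c * prod_list (map C w)" if "p \<in> admissible R" for p
    proof -
      interpret cs_seminorm p using that by unfold_locales (simp add: admissible_def)
      have "p (prod_list (map gen w)) \<le> prod_list (map (\<lambda>g. p (gen g)) w)"
        using cs_seminorm_le[OF cs cstar_seminorm_one[OF cs]] .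
      also have "\<dots> \<le> prod_list (map C w)"
      proof (induction w)
        case (Cons g w)
        have "0 \<le> prod_list (map (\<lambda>g. p (gen g)) w)" by (induction w) auto
        then show ?case using Cons C[OF that, of g] order_trans[OF p_nonneg C[OF that, of g]]
          by (auto intro!: mult_mono)
      qed simp
      finally show ?thesis by (simp add: gen_word p_scale mult_left_mono)
    qed
    then show ?case by blast
  next
    case (add a b)
    then obtain A B where "\<forall>p\<in>admissible R. p a \<le> A" "\<forall>p\<in>admissible R. p b \<le> B" by blast
    moreover have "p (a + b) \<le> p a + p b" if "p \<in> admissible R" for p
      using that by (auto simp: admissible_def cstar_seminorm_def)
    ultimately have "\<forall>p\<in>admissible R. p (a + b) \<le> A + B" by (meson add_mono order_trans)
    then show ?case by blast
  qed
qed

lemma universal_seminorm: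
  assumes "\<And>g. \<exists>C. \<forall>p\<in>admissible R. p (gen g) \<le> C"
  shows admissible_le: "\<And>p a. p \<in> admissible R \<Longrightarrow> p a \<le> universal_seminorm R a"
    and universal_admissible: "universal_seminorm R \<in> admissible R"
proof -
  let ?u = "universal_seminorm R"
  have adm: "cs_seminorm p" if "p \<in> admissible R" for p
    using that by (simp add: admissible_def cs_seminorm_def)
  show le: "p a \<le> ?u a" if "p \<in> admissible R" for p a
    unfolding universal_seminorm_def
    using admissible_bdd[OF assms, of a] that by (intro cSUP_upper) (auto simp: bdd_above_def)
  have least: "?u a \<le> C" if "\<And>p. p \<in> admissible R \<Longrightarrow> p a \<le> C" for a C
    unfolding universal_seminorm_def using that admissible_zero by (intro cSUP_least) auto
  have nn: "0 \<le> ?u a" for a using le[OF admissible_zero] .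
  have sc: "?u (fscale c a) \<le> cmod c * ?u a" for c a
    by (rule least) (simp add: cs_seminorm.p_scale[OF adm] le mult_left_mono)
  have "cstar_seminorm ?u"
    unfolding cstar_seminorm_def
  proof (intro conjI allI)
    fix a b c
    show "?u (a + b) \<le> ?u a + ?u b"
      by (rule least) (meson cs_seminorm.p_add[OF adm] le add_mono order_trans)
    show "?u (a * b) \<le> ?u a * ?u b"
      by (rule least)
         (meson cs_seminorm.p_mult[OF adm] cs_seminorm.p_nonneg[OF adm] le nn mult_mono order_trans)
    show "?u (fscale c a) = cmod c * ?u a"
    proof (cases "c = 0")
      case True
      then show ?thesis using sc[of 0 a] nn[of "fscale 0 a"] by simp
    next
      case False
      have "?u a \<le> cmod (inverse c) * ?u (fscale c a)"
        using sc[of "inverse c" "fscale c a"] False by (simp add: fscale_fscale)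
      then show ?thesis using sc[of c a] False by (simp add: norm_divide field_simps)
    qed
    show "?u (fstar a * a) = (?u a)\<^sup>2"
    proof (rule antisym)
      show "?u (fstar a * a) \<le> (?u a)\<^sup>2"
        by (rule least)
           (simp add: cs_seminorm.p_star[OF adm] power_mono le cs_seminorm.p_nonneg[OF adm])
      have "p a \<le> sqrt (?u (fstar a * a))" if "p \<in> admissible R" for p
        by (rule real_le_rsqrt) (metis cs_seminorm.p_star[OF adm[OF that]] le[OF that])
      then have "?u a \<le> sqrt (?u (fstar a * a))" by (rule least)
      then show "(?u a)\<^sup>2 \<le> ?u (fstar a * a)" using nn
        by (metis power_mono real_sqrt_pow2)
    qed
  qed
  moreover have "?u r = 0" if "r \<in> R" for r
    using least[of r 0] nn[of r] that by (auto simp: admissible_def)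
  ultimately show "?u \<in> admissible R" by (simp add: admissible_def)
qed

lemma magic_bdd: "\<exists>C. \<forall>p\<in>admissible (magic_relations N). p (gen g) \<le> C"
proof -
  have "p (gen g) \<le> 1" if "p \<in> admissible (magic_relations N)" for p
  proof -
    interpret cs_seminorm p using that by unfold_locales (simp add: admissible_def)
    have r: "p r = 0" if "r \<in> magic_relations N" for r
      using \<open>p \<in> _\<close> that by (simp add: admissible_def)
    obtain i j where g: "g = (i, j)" by (cases g)
    show ?thesis
    proof (cases "i \<in> {1..N} \<and> j \<in> {1..N}")
      case True
      then have "p (gen g * gen g - gen g) = 0"
        unfolding g by (intro r) (unfold magic_relations_def, blast)
      then have "p (gen g * gen g) = p (gen g)" using p_absdiff[of "gen g * gen g" "gen g"] by simp
      then have "p (gen g) * p (gen g) = p (gen g)"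
        using p_star[of "gen g"] by (simp add: power2_eq_square)
      then have "p (gen g) = 0 \<or> p (gen g) = 1" by simp
      then show ?thesis by linarith
    next
      case False
      then have "gen g \<in> magic_relations N" unfolding g magic_relations_def by blast
      then have "p (gen g) = 0" by (rule r)
      then show ?thesis by simp
    qed
  qed
  then show ?thesis by blast
qed

lemma magic_seminorm: "cs_seminorm (universal_seminorm (magic_relations N))"
  using universal_admissible[OF magic_bdd, of N] by (simp add: admissible_def cs_seminorm_def)

theorem cstar_C_qperm: "cstar_algebra (C_qperm N)"
  unfolding C_qperm_def by (rule cs_seminorm.cstar_completion[OF magic_seminorm])

theorem magic_qperm_gen: "magic_unitary (C_qperm N) N (qperm_gen N)"
proof -
  let ?p = "universal_seminorm (magic_relations N)"
  interpret cs_seminorm ?p by (rule magic_seminorm)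
  interpret Q: cstar_algebra "C_qperm N" by (rule cstar_C_qperm)
  have Q: "C_qperm N = completion ?p" by (simp add: C_qperm_def)
  have r: "?p r = 0" if "r \<in> magic_relations N" for r
    using universal_admissible[OF magic_bdd, of N] that by (simp add: admissible_def)
  have gc: "seq_class ?p (\<lambda>n. a) \<in> carrier (C_qperm N)" for a
    by (simp add: Q carrier_completion)
  have sum: "(\<Oplus>\<^bsub>C_qperm N\<^esub>k\<in>S. seq_class ?p (\<lambda>n. f k)) = seq_class ?p (\<lambda>n. \<Sum>k\<in>S. f k)"
    if "finite S" for S :: "nat set" and f
    using that
  proof (induction S)
    case empty
    show ?case by (simp, simp add: Q zero_completion)
  next
    case (insert k S)
    then show ?case using gc by (simp add: Pi_def) (simp add: Q completion_simps)
  qed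
  have eq: "seq_class ?p (\<lambda>n. a) = seq_class ?p (\<lambda>n. b)" if "a - b \<in> magic_relations N" for a b
    using r[OF that] by (simp add: seq_class_eq eqv_def)
  show ?thesis
    unfolding magic_unitary_def
  proof (intro conjI ballI)
    fix i j assume ij: "i \<in> {1..N}" "j \<in> {1..N}"
    show "qperm_gen N i j \<in> carrier (C_qperm N)" by (simp add: qperm_gen_def gc)
    show "star (C_qperm N) (qperm_gen N i j) = qperm_gen N i j"
      by (simp add: qperm_gen_def Q completion_simps)
    show "qperm_gen N i j \<otimes>\<^bsub>C_qperm N\<^esub> qperm_gen N i j = qperm_gen N i j"
      unfolding qperm_gen_def Q mult_completion[OF cau_const cau_const]
      using ij by (intro eq) (auto simp: magic_relations_def)
  next
    fix i assume "i \<in> {1..N}"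
    then show "(\<Oplus>\<^bsub>C_qperm N\<^esub>j\<in>{1..N}. qperm_gen N i j) = \<one>\<^bsub>C_qperm N\<^esub>"
      unfolding qperm_gen_def sum[OF finite_atLeastAtMost]
      unfolding Q one_completion by (intro eq) (auto simp: magic_relations_def)
  next
    fix j assume "j \<in> {1..N}"
    then show "(\<Oplus>\<^bsub>C_qperm N\<^esub>i\<in>{1..N}. qperm_gen N i j) = \<one>\<^bsub>C_qperm N\<^esub>"
      unfolding qperm_gen_def sum[OF finite_atLeastAtMost]
      unfolding Q one_completion by (intro eq) (auto simp: magic_relations_def)
  qed
qed

subsection \<open>Norm limits in a C*-algebra\<close>

context cstar_algebra
begin

lemma smult_zero_left [simp]: "x \<in> carrier A \<Longrightarrow> 0 \<odot> x = \<zero>"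
  using smult_l_distr[of x 0 0] add.r_cancel_one[of "0 \<odot> x" "0 \<odot> x"] by auto

lemma smult_minus_one: "x \<in> carrier A \<Longrightarrow> (- 1) \<odot> x = \<ominus> x"
  using smult_l_distr[of x "-1" 1] minus_equality[of "(-1) \<odot> x" x] by auto

lemma smult_zero_right [simp]: "c \<odot> \<zero> = \<zero>"
  using smult_assoc[of \<zero> c 0] by simp

lemma cnorm_zero [simp]: "cnorm A \<zero> = 0"
  using cnorm_smult[of \<zero> 0] by simp

lemma cnorm_uminus: "x \<in> carrier A \<Longrightarrow> cnorm A (\<ominus> x) = cnorm A x"
  using cnorm_smult[of x "-1"] by (simp add: smult_minus_one)

lemma cnorm_nonneg: "x \<in> carrier A \<Longrightarrow> 0 \<le> cnorm A x"
  using cnorm_triangle[of x "\<ominus> x"] by (simp add: cnorm_uminus r_neg)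

lemma cnorm_diff: "x \<in> carrier A \<Longrightarrow> y \<in> carrier A \<Longrightarrow> cnorm A (x \<ominus> y) \<le> cnorm A x + cnorm A y"
  using cnorm_triangle[of x "\<ominus> y"] by (simp add: cnorm_uminus a_minus_def)

lemma cnorm_swap: "x \<in> carrier A \<Longrightarrow> y \<in> carrier A \<Longrightarrow> cnorm A (x \<ominus> y) = cnorm A (y \<ominus> x)"
  using cnorm_uminus[of "x \<ominus> y"] by (simp add: a_minus_def minus_add a_comm)

lemma cnorm_diff_triangle:
  assumes "x \<in> carrier A" "y \<in> carrier A" "z \<in> carrier A"
  shows "cnorm A (x \<ominus> z) \<le> cnorm A (x \<ominus> y) + cnorm A (y \<ominus> z)"
proof -
  have "x \<ominus> z = (x \<ominus> y) \<oplus> (y \<ominus> z)"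
    using assms by (simp add: a_minus_def a_assoc r_neg1)
  then show ?thesis using cnorm_triangle[of "x \<ominus> y" "y \<ominus> z"] assms by simp
qed

lemma cnorm_star: assumes "x \<in> carrier A" shows "cnorm A (star A x) = cnorm A x"
proof -
  have *: "cnorm A y \<le> cnorm A (star A y)" if "y \<in> carrier A" for y
  proof (cases "cnorm A y = 0")
    case False
    then have "0 < cnorm A y" using cnorm_nonneg[OF that] by simp
    moreover have "cnorm A y * cnorm A y \<le> cnorm A (star A y) * cnorm A y"
      using cnorm_mult[of "star A y" y] cstar_identity[of y] that by (simp add: power2_eq_square)
    ultimately show ?thesis by simp
  qed (use that cnorm_nonneg in simp)
  from *[of x] *[of "star A x"] assms show ?thesis by simp
qed

lemma cnorm_one_le: "cnorm A \<one> \<le> 1"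
proof -
  have "star A \<one> = \<one>" using star_mult[of "star A \<one>" \<one>] by simp
  then have "cnorm A \<one> * cnorm A \<one> = cnorm A \<one>"
    using cstar_identity[of \<one>] by (simp add: power2_eq_square)
  then show ?thesis by auto
qed

lemma star_one [simp]: "star A \<one> = \<one>"
  using star_mult[of "star A \<one>" \<one>] by simp

lemma star_minus: "x \<in> carrier A \<Longrightarrow> star A (\<ominus> x) = \<ominus> star A x"
  by (simp add: smult_minus_one[symmetric] star_smult)

lemma star_diff: "x \<in> carrier A \<Longrightarrow> y \<in> carrier A \<Longrightarrow> star A (x \<ominus> y) = star A x \<ominus> star A y"
  by (simp add: a_minus_def star_add star_minus)

lemma smult_uminus: "x \<in> carrier A \<Longrightarrow> c \<odot> (\<ominus> x) = \<ominus> (c \<odot> x)"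
  by (simp add: smult_assoc[symmetric] smult_minus_one[symmetric] mult.commute)

lemma smult_diff: "x \<in> carrier A \<Longrightarrow> y \<in> carrier A \<Longrightarrow> c \<odot> (x \<ominus> y) = c \<odot> x \<ominus> c \<odot> y"
  by (simp add: a_minus_def smult_r_distr smult_assoc[symmetric] smult_minus_one[symmetric] mult.commute)

definition tends :: "(nat \<Rightarrow> 'a) \<Rightarrow> 'a \<Rightarrow> bool" where
  "tends X l \<longleftrightarrow> (\<forall>n. X n \<in> carrier A) \<and> l \<in> carrier A \<and> (\<lambda>n. cnorm A (X n \<ominus> l)) \<longlonglongrightarrow> 0"

lemma tends_carrier: "tends X l \<Longrightarrow> X n \<in> carrier A" "tends X l \<Longrightarrow> l \<in> carrier A"
  by (auto simp: tends_def)

lemma tends_const [simp]: "l \<in> carrier A \<Longrightarrow> tends (\<lambda>n. l) l"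
  by (simp add: tends_def r_neg a_minus_def)

lemma tends_unique: assumes "tends X l" "tends X m" shows "l = m"
proof -
  note c = assms[THEN tends_carrier(1)] assms[THEN tends_carrier(2)]
  have "(\<lambda>n. cnorm A (X n \<ominus> l) + cnorm A (X n \<ominus> m)) \<longlonglongrightarrow> 0 + 0"
    using assms unfolding tends_def by (intro tendsto_add) auto
  moreover have "cnorm A (l \<ominus> m) \<le> cnorm A (X n \<ominus> l) + cnorm A (X n \<ominus> m)" for n
    using cnorm_diff_triangle[of l "X n" m] cnorm_swap[of l "X n"] c by simp
  ultimately have "cnorm A (l \<ominus> m) \<le> 0 + 0" by (intro LIMSEQ_le_const) auto
  then have "l \<ominus> m = \<zero>" using cnorm_eq_zero[of "l \<ominus> m"] cnorm_nonneg[of "l \<ominus> m"] c by simp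
  moreover have "l = (l \<ominus> m) \<oplus> m" using c by (simp add: a_minus_def a_assoc l_neg)
  ultimately show ?thesis using c by simp
qed

lemma tends_bound:
  assumes "\<And>n. Y n \<in> carrier A" "m \<in> carrier A" "\<And>n. cnorm A (Y n \<ominus> m) \<le> b n" "b \<longlonglongrightarrow> 0"
  shows "tends Y m"
  unfolding tends_def
proof (intro conjI allI assms(1,2))
  show "(\<lambda>n. cnorm A (Y n \<ominus> m)) \<longlonglongrightarrow> 0"
    by (rule tendsto_sandwich[where f = "\<lambda>n. 0", OF _ _ tendsto_const assms(4)];
        intro always_eventually allI) (simp_all add: assms cnorm_nonneg)
qed

lemma tends_add: assumes "tends X l" "tends Y m" shows "tends (\<lambda>n. X n \<oplus> Y n) (l \<oplus> m)"
proof (rule tends_bound)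
  note c [simp] = assms[THEN tends_carrier(1)] assms[THEN tends_carrier(2)]
  show "cnorm A (X n \<oplus> Y n \<ominus> (l \<oplus> m)) \<le> cnorm A (X n \<ominus> l) + cnorm A (Y n \<ominus> m)" for n
  proof -
    have "X n \<oplus> Y n \<ominus> (l \<oplus> m) = (X n \<ominus> l) \<oplus> (Y n \<ominus> m)"
      by (simp add: a_minus_def minus_add a_ac)
    then show ?thesis using cnorm_triangle by simp
  qed
  show "(\<lambda>n. cnorm A (X n \<ominus> l) + cnorm A (Y n \<ominus> m)) \<longlonglongrightarrow> 0"
    using tendsto_add[of _ 0 _ _ 0] assms unfolding tends_def by fastforce
qed (use assms tends_carrier in auto)

lemma tends_smult: assumes "tends X l" shows "tends (\<lambda>n. c \<odot> X n) (c \<odot> l)"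
proof (rule tends_bound)
  note c [simp] = assms[THEN tends_carrier(1)] assms[THEN tends_carrier(2)]
  show "cnorm A (c \<odot> X n \<ominus> c \<odot> l) \<le> cmod c * cnorm A (X n \<ominus> l)" for n
    by (simp add: smult_diff[symmetric] cnorm_smult)
  show "(\<lambda>n. cmod c * cnorm A (X n \<ominus> l)) \<longlonglongrightarrow> 0"
    using assms unfolding tends_def by (auto intro: tendsto_mult_right_zero)
qed (use assms tends_carrier in auto)

lemma tends_star: assumes "tends X l" shows "tends (\<lambda>n. star A (X n)) (star A l)"
proof (rule tends_bound)
  note c [simp] = assms[THEN tends_carrier(1)] assms[THEN tends_carrier(2)]
  show "cnorm A (star A (X n) \<ominus> star A l) \<le> cnorm A (X n \<ominus> l)" for n
    by (simp add: star_diff[symmetric] cnorm_star)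
  show "(\<lambda>n. cnorm A (X n \<ominus> l)) \<longlonglongrightarrow> 0" using assms unfolding tends_def by simp
qed (use assms tends_carrier in auto)

lemma tends_norm: assumes "tends X l" shows "(\<lambda>n. cnorm A (X n)) \<longlonglongrightarrow> cnorm A l"
proof -
  note c [simp] = assms[THEN tends_carrier(1)] assms[THEN tends_carrier(2)]
  have 1: "\<bar>cnorm A (X n) - cnorm A l\<bar> \<le> cnorm A (X n \<ominus> l)" for n
  proof -
    have "cnorm A (X n) \<le> cnorm A (X n \<ominus> l) + cnorm A l"
      "cnorm A l \<le> cnorm A (X n \<ominus> l) + cnorm A (X n)"
      using cnorm_diff_triangle[of "X n" l \<zero>] cnorm_diff_triangle[of l "X n" \<zero>] cnorm_swap[of l "X n"]
      by (simp_all add: a_minus_def)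
    then show ?thesis by linarith
  qed
  have 2: "(\<lambda>n. cnorm A (X n \<ominus> l)) \<longlonglongrightarrow> 0" using assms by (simp add: tends_def)
  have "(\<lambda>n. \<bar>cnorm A (X n) - cnorm A l\<bar>) \<longlonglongrightarrow> 0"
  proof (rule tendsto_sandwich[OF _ _ tendsto_const 2])
    show "\<forall>\<^sub>F n in sequentially. \<bar>cnorm A (X n) - cnorm A l\<bar> \<le> cnorm A (X n \<ominus> l)"
      by (rule always_eventually, rule allI, rule 1)
  qed simp
  then have "(\<lambda>n. cnorm A (X n) - cnorm A l) \<longlonglongrightarrow> 0" by (rule tendsto_rabs_zero_cancel)
  then show ?thesis by (simp add: LIM_zero_iff)
qed

lemma mult_diff_eq:
  assumes [simp]: "x \<in> carrier A" "y \<in> carrier A" "z \<in> carrier A" "w \<in> carrier A"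
  shows "x \<otimes> y \<ominus> z \<otimes> w = (x \<ominus> z) \<otimes> y \<oplus> z \<otimes> (y \<ominus> w)"
  by (simp add: a_minus_def l_distr r_distr l_minus r_minus a_assoc r_neg1)

lemma tends_mult: assumes "tends X l" "tends Y m" shows "tends (\<lambda>n. X n \<otimes> Y n) (l \<otimes> m)"
proof (rule tends_bound)
  note c [simp] = assms[THEN tends_carrier(1)] assms[THEN tends_carrier(2)]
  show "cnorm A (X n \<otimes> Y n \<ominus> l \<otimes> m)
      \<le> cnorm A (X n \<ominus> l) * cnorm A (Y n) + cnorm A l * cnorm A (Y n \<ominus> m)" for n
    using cnorm_triangle[of "(X n \<ominus> l) \<otimes> Y n" "l \<otimes> (Y n \<ominus> m)"]
      cnorm_mult[of "X n \<ominus> l" "Y n"] cnorm_mult[of l "Y n \<ominus> m"]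
    by (simp add: mult_diff_eq)
  have "(\<lambda>n. cnorm A (X n \<ominus> l) * cnorm A (Y n) + cnorm A l * cnorm A (Y n \<ominus> m))
      \<longlonglongrightarrow> 0 * cnorm A m + cnorm A l * 0"
    using assms tends_norm unfolding tends_def
    by (intro tendsto_add tendsto_mult tendsto_const) auto
  then show "(\<lambda>n. cnorm A (X n \<ominus> l) * cnorm A (Y n) + cnorm A l * cnorm A (Y n \<ominus> m)) \<longlonglongrightarrow> 0"
    by simp
qed (use assms tends_carrier in auto)

end

subsection \<open>Homomorphisms of C*-algebras are contractive\<close>

text \<open>A self-adjoint \<open>h\<close> of norm below one is the real part of a unitary \<open>h + ik\<close>; the root
  \<open>k = 1 - l\<close> of \<open>1 - h\<^sup>2\<close> is obtained from the fixed point \<open>l = (h\<^sup>2 + l\<^sup>2)/2\<close>.\<close>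

lemma cstar_homD:
  assumes "f \<in> cstar_hom A B"
  shows "x \<in> carrier A \<Longrightarrow> f x \<in> carrier B"
    and "x \<in> carrier A \<Longrightarrow> y \<in> carrier A \<Longrightarrow> f (x \<oplus>\<^bsub>A\<^esub> y) = f x \<oplus>\<^bsub>B\<^esub> f y"
    and "x \<in> carrier A \<Longrightarrow> y \<in> carrier A \<Longrightarrow> f (x \<otimes>\<^bsub>A\<^esub> y) = f x \<otimes>\<^bsub>B\<^esub> f y"
    and "f \<one>\<^bsub>A\<^esub> = \<one>\<^bsub>B\<^esub>"
    and "x \<in> carrier A \<Longrightarrow> f (star A x) = star B (f x)"
    and "x \<in> carrier A \<Longrightarrow> f (c \<odot>\<^bsub>A\<^esub> x) = c \<odot>\<^bsub>B\<^esub> f x"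
  using assms unfolding cstar_hom_def ring_hom_def by auto

context cstar_algebra
begin

lemma sqrt_exists:
  assumes h: "h \<in> carrier A" "star A h = h" "cnorm A h < 1"
  shows "\<exists>k\<in>carrier A. star A k = k \<and> h \<otimes> k = k \<otimes> h \<and> h \<otimes> h \<oplus> k \<otimes> k = \<one>"
proof -
  define b where "b = h \<otimes> h"
  define c where "c = (cnorm A h)\<^sup>2"
  define \<tau> where "\<tau> = 1 - sqrt (1 - c)"
  have c: "0 \<le> c" "c < 1" using h cnorm_nonneg[of h] by (auto simp: c_def power_less_one_iff abs_square_less_1)
  then have \<tau>: "0 \<le> \<tau>" "\<tau> < 1" "(c + \<tau> * \<tau>) / 2 = \<tau>"
    by (auto simp: \<tau>_def algebra_simps add_divide_distrib diff_divide_distrib)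
  have b [simp]: "b \<in> carrier A" and sb: "star A b = b" and nb: "cnorm A b = c"
    using h cstar_identity[of h] by (auto simp: b_def star_mult c_def)
  define t where "t = rec_nat \<zero> (\<lambda>_ x. (1/2) \<odot> (b \<oplus> x \<otimes> x))"
  have t0 [simp]: "t 0 = \<zero>" and tS: "t (Suc n) = (1/2) \<odot> (b \<oplus> t n \<otimes> t n)" for n
    by (simp_all add: t_def)
  have tc [simp]: "t n \<in> carrier A" for n by (induction n) (auto simp: tS)
  have ts: "star A (t n) = t n" for n
  proof (induction n)
    case 0
    show ?case using star_smult[of \<zero> 0] by simp
  qed (simp add: tS star_smult star_add star_mult sb)
  have tcom: "x \<otimes> t n = t n \<otimes> x" if "x \<in> carrier A" "x \<otimes> b = b \<otimes> x" for x n
  proof (induction n)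
    case (Suc n)
    have "x \<otimes> (t n \<otimes> t n) = t n \<otimes> t n \<otimes> x" using that Suc by (metis m_assoc tc)
    then show ?case using that by (simp add: tS smult_mult_left smult_mult_right l_distr r_distr)
  qed (use that in simp)
  have hb: "h \<otimes> b = b \<otimes> h" using h by (simp add: b_def m_assoc)
  have tt: "t m \<otimes> t n = t n \<otimes> t m" for m n
    using tcom[of "t m" n] tcom[of b m] by simp
  have tn: "cnorm A (t n) \<le> \<tau>" for n
  proof (induction n)
    case (Suc n)
    have "cnorm A (t n \<otimes> t n) \<le> \<tau> * \<tau>"
      using cnorm_mult[of "t n" "t n"] mult_mono[OF Suc Suc \<tau>(1) cnorm_nonneg] by simp
    then have "cnorm A (b \<oplus> t n \<otimes> t n) \<le> c + \<tau> * \<tau>"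
      using cnorm_triangle[of b "t n \<otimes> t n"] nb by simp
    then have "cnorm A (t (Suc n)) \<le> (c + \<tau> * \<tau>) / 2"
      by (simp add: tS cnorm_smult)
    then show ?case using \<tau>(3) by simp
  qed (use \<tau> in simp)
  have step: "cnorm A (t (Suc m) \<ominus> t (Suc n)) \<le> \<tau> * cnorm A (t m \<ominus> t n)" for m n
  proof -
    have "t m \<otimes> t m \<ominus> t n \<otimes> t n = (t m \<oplus> t n) \<otimes> (t m \<ominus> t n)"
      by (simp add: mult_diff_eq a_minus_def l_distr r_distr l_minus r_minus tt[of n m] a_ac minus_add r_neg1 r_neg2)
    moreover have "t (Suc m) \<ominus> t (Suc n) = (1/2) \<odot> (t m \<otimes> t m \<ominus> t n \<otimes> t n)"
    proof -
      have "(b \<oplus> t m \<otimes> t m) \<ominus> (b \<oplus> t n \<otimes> t n) = t m \<otimes> t m \<ominus> t n \<otimes> t n"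
        by (simp add: a_minus_def minus_add a_ac r_neg2 r_neg1)
      then show ?thesis by (simp add: tS smult_diff[symmetric])
    qed
    moreover have "cnorm A ((t m \<oplus> t n) \<otimes> (t m \<ominus> t n)) \<le> (\<tau> + \<tau>) * cnorm A (t m \<ominus> t n)"
      by (rule order_trans[OF cnorm_mult])
         (use tn[of m] tn[of n] in
           \<open>auto intro!: mult_right_mono cnorm_nonneg order_trans[OF cnorm_triangle]\<close>)
    ultimately show ?thesis by (simp add: cnorm_smult)
  qed
  have diff: "cnorm A (t (n + k) \<ominus> t n) \<le> \<tau> ^ n" for n k
  proof (induction n)
    case 0
    then show ?case using tn[of k] \<tau>(2) by (simp add: a_minus_def)
  next
    case (Suc n)
    have "cnorm A (t (Suc (n + k)) \<ominus> t (Suc n)) \<le> \<tau> * \<tau> ^ n"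
      using step[of "n + k" n] mult_left_mono[OF Suc \<tau>(1)] by linarith
    then show ?case by simp
  qed
  have "\<exists>l\<in>carrier A. (\<lambda>n. cnorm A (t n \<ominus> l)) \<longlonglongrightarrow> 0"
  proof (rule complete)
    fix e :: real assume "e > 0"
    have "(\<lambda>n. \<tau> ^ n) \<longlonglongrightarrow> 0" using \<tau> by (simp add: LIMSEQ_realpow_zero)
    then obtain M where M: "\<And>n. n \<ge> M \<Longrightarrow> \<tau> ^ n < e"
      using LIMSEQ_D[OF _ \<open>e > 0\<close>, of "\<lambda>n. \<tau> ^ n" 0] \<tau> by auto
    have "cnorm A (t m \<ominus> t n) < e" if "m \<ge> M" "n \<ge> M" for m n
    proof (cases "m \<ge> n")
      case True
      then show ?thesis using diff[of n "m - n"] M[of n] that by simp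
    next
      case False
      then show ?thesis using diff[of m "n - m"] M[of m] that cnorm_swap[of "t m" "t n"] by simp
    qed
    then show "\<exists>M. \<forall>m\<ge>M. \<forall>n\<ge>M. cnorm A (t m \<ominus> t n) < e" by blast
  qed simp
  then obtain l where l: "tends t l" by (auto simp: tends_def)
  note lc [simp] = tends_carrier(2)[OF l]
  have sl: "star A l = l" 
  proof (rule tends_unique[OF _ l])
    show "tends t (star A l)" using tends_star[OF l] by (simp add: ts)
  qed
  have hl: "h \<otimes> l = l \<otimes> h"
  proof (rule tends_unique)
    show "tends (\<lambda>n. h \<otimes> t n) (h \<otimes> l)" by (rule tends_mult[OF tends_const[OF h(1)] l])
    show "tends (\<lambda>n. h \<otimes> t n) (l \<otimes> h)"
      unfolding tcom[OF h(1) hb] by (rule tends_mult[OF l tends_const[OF h(1)]])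
  qed
  have "tends (\<lambda>n. t (Suc n)) l"
    using l LIMSEQ_Suc[of "\<lambda>n. cnorm A (t n \<ominus> l)" 0] by (simp add: tends_def)
  moreover have "tends (\<lambda>n. t (Suc n)) ((1/2) \<odot> (b \<oplus> l \<otimes> l))"
    unfolding tS by (intro tends_smult tends_add tends_mult tends_const l b)
  ultimately have lfix: "l = (1/2) \<odot> (b \<oplus> l \<otimes> l)" by (rule tends_unique)
  have "l \<oplus> l = b \<oplus> l \<otimes> l"
  proof -
    have "l \<oplus> l = (1/2 + 1/2) \<odot> (b \<oplus> l \<otimes> l)"
      by (subst (1 2) lfix) (simp only: smult_l_distr b lc a_closed m_closed)
    then show ?thesis by simp
  qed
  define k where "k = \<one> \<ominus> l"
  have "k \<otimes> k \<oplus> b = \<one>"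
  proof -
    have "k \<otimes> k \<oplus> (l \<oplus> l) = \<one> \<oplus> l \<otimes> l"
      by (simp add: k_def a_minus_def l_distr r_distr l_minus r_minus minus_add a_ac r_neg2 r_neg1 r_neg)
    then have "k \<otimes> k \<oplus> b \<oplus> l \<otimes> l = \<one> \<oplus> l \<otimes> l"
      using \<open>l \<oplus> l = _\<close> by (simp add: k_def a_assoc)
    then show ?thesis
      using add.right_cancel[of "l \<otimes> l" "k \<otimes> k \<oplus> b" \<one>] by (simp add: k_def)
  qed
  then have "h \<otimes> h \<oplus> k \<otimes> k = \<one>"
    using b by (simp add: b_def[symmetric] k_def a_comm)
  moreover have "k \<in> carrier A" "star A k = k" "h \<otimes> k = k \<otimes> h"
    using h by (simp_all add: k_def star_add star_minus sl a_minus_def l_distr r_distr l_minus r_minus hl)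
  ultimately show ?thesis by blast
qed

end

lemma cstar_hom_contractive:
  assumes A: "cstar_algebra A" and B: "cstar_algebra B" and f: "f \<in> cstar_hom A B"
    and x: "x \<in> carrier A"
  shows "cnorm B (f x) \<le> cnorm A x"
proof -
  interpret A: cstar_algebra A by fact
  interpret B: cstar_algebra B by fact
  note f' [simp] = cstar_homD[OF f]
  have sa: "cnorm B (f h) \<le> 1" if h: "h \<in> carrier A" "star A h = h" "cnorm A h < 1" for h
  proof -
    obtain k where k: "k \<in> carrier A" "star A k = k" "h \<otimes>\<^bsub>A\<^esub> k = k \<otimes>\<^bsub>A\<^esub> h"
        "h \<otimes>\<^bsub>A\<^esub> h \<oplus>\<^bsub>A\<^esub> k \<otimes>\<^bsub>A\<^esub> k = \<one>\<^bsub>A\<^esub>"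
      using A.sqrt_exists[OF h] by blast
    define w where "w = h \<oplus>\<^bsub>A\<^esub> \<i> \<odot>\<^bsub>A\<^esub> k"
    have w: "w \<in> carrier A" using h k by (simp add: w_def)
    have sw: "star A w = h \<ominus>\<^bsub>A\<^esub> \<i> \<odot>\<^bsub>A\<^esub> k"
      using h k by (simp add: w_def A.star_add A.star_smult a_minus_def A.smult_minus_one[symmetric]
        A.smult_assoc[symmetric])
    have "star A w \<otimes>\<^bsub>A\<^esub> w = h \<otimes>\<^bsub>A\<^esub> h \<oplus>\<^bsub>A\<^esub> k \<otimes>\<^bsub>A\<^esub> k"
      unfolding sw unfolding w_def using h(1) k(1)
      by (simp add: a_minus_def A.l_distr A.r_distr A.l_minus A.r_minus A.smult_mult_left
          A.smult_mult_right A.smult_assoc[symmetric] A.smult_minus_one k(3)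
          A.smult_r_distr A.smult_uminus
          A.a_ac A.r_neg1 A.r_neg2 A.r_neg)
    then have "star B (f w) \<otimes>\<^bsub>B\<^esub> f w = \<one>\<^bsub>B\<^esub>" using w k(4) f' by (metis A.star_closed)
    then have "(cnorm B (f w))\<^sup>2 \<le> 1" using B.cstar_identity[of "f w"] B.cnorm_one_le w by simp
    then have nw: "cnorm B (f w) \<le> 1" using power2_le_imp_le[of _ 1] by simp
    have "w \<oplus>\<^bsub>A\<^esub> star A w = h \<oplus>\<^bsub>A\<^esub> h"
      unfolding sw unfolding w_def using h(1) k(1) by (simp add: a_minus_def A.a_ac A.r_neg1 A.r_neg2 A.r_neg)
    then have "f w \<oplus>\<^bsub>B\<^esub> star B (f w) = f h \<oplus>\<^bsub>B\<^esub> f h" using w h f' by (metis A.star_closed)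
    moreover have "f h \<oplus>\<^bsub>B\<^esub> f h = 2 \<odot>\<^bsub>B\<^esub> f h"
      using B.smult_l_distr[of "f h" 1 1] h by simp
    moreover have "cnorm B (f w \<oplus>\<^bsub>B\<^esub> star B (f w)) \<le> 1 + 1"
      using B.cnorm_triangle[of "f w" "star B (f w)"] nw B.cnorm_star[of "f w"] w by simp
    ultimately show ?thesis using B.cnorm_smult[of "f h" 2] h by simp
  qed
  have sa': "cnorm B (f h) \<le> cnorm A h" if h: "h \<in> carrier A" "star A h = h" for h
  proof (rule field_le_epsilon)
    fix e :: real assume "e > 0"
    define s where "s = cnorm A h + e"
    have s: "s > 0" using \<open>e > 0\<close> A.cnorm_nonneg[OF h(1)] by (simp add: s_def)
    then have cm: "cmod (complex_of_real (1 / s)) = 1 / s" unfolding norm_of_real by simp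
    have "cnorm B (f (complex_of_real (1 / s) \<odot>\<^bsub>A\<^esub> h)) \<le> 1"
    proof (rule sa)
      have "cmod (complex_of_real (1 / s)) * cnorm A h < 1"
        unfolding cm using s \<open>e > 0\<close> by (simp add: s_def)
      then show "cnorm A (complex_of_real (1 / s) \<odot>\<^bsub>A\<^esub> h) < 1" using h by (simp only: A.cnorm_smult)
    qed (use h in \<open>auto simp: A.star_smult\<close>)
    then have "cmod (complex_of_real (1 / s)) * cnorm B (f h) \<le> 1"
      using h by (simp only: f' B.cnorm_smult)
    then show "cnorm B (f h) \<le> cnorm A h + e"
      unfolding cm using s by (simp add: s_def field_simps)
  qed
  have "(cnorm B (f x))\<^sup>2 = cnorm B (f (star A x \<otimes>\<^bsub>A\<^esub> x))"
    using x by (simp add: B.cstar_identity)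
  also have "\<dots> \<le> cnorm A (star A x \<otimes>\<^bsub>A\<^esub> x)" using x by (intro sa') (auto simp: A.star_mult)
  also have "\<dots> = (cnorm A x)\<^sup>2" using x by (simp add: A.cstar_identity)
  finally show ?thesis using A.cnorm_nonneg[OF x] power2_le_imp_le by blast
qed

subsection \<open>The universal property\<close>

context cstar_algebra
begin

definition word_prod :: "('g \<Rightarrow> 'a) \<Rightarrow> 'g list \<Rightarrow> 'a" where
  "word_prod v w = foldr (\<lambda>g x. v g \<otimes> x) w \<one>"

definition ev :: "('g \<Rightarrow> 'a) \<Rightarrow> 'g falg \<Rightarrow> 'a" where
  "ev v a = (\<Oplus>w\<in>Poly_Mapping.keys a. Poly_Mapping.lookup a w \<odot> word_prod v w)"

context
  fixes v :: "'g \<Rightarrow> 'a"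
  assumes v [simp]: "\<And>g. v g \<in> carrier A" and vs: "\<And>g. star A (v g) = v g"
begin

lemma word_prod_closed [simp]: "word_prod v w \<in> carrier A"
  by (induction w) (auto simp: word_prod_def)

lemma word_prod_append: "word_prod v (w @ w') = word_prod v w \<otimes> word_prod v w'"
proof (induction w)
  case Nil
  show ?case using word_prod_closed[of w'] by (simp add: word_prod_def)
next
  case (Cons g w)
  then show ?case
    using word_prod_closed[of w] word_prod_closed[of w'] by (simp add: word_prod_def m_assoc)
qed

lemma word_prod_rev: "star A (word_prod v w) = word_prod v (rev w)"
proof (induction w)
  case Nil
  show ?case by (simp add: word_prod_def)
next
  case (Cons g w)
  have "word_prod v (g # w) = v g \<otimes> word_prod v w" by (simp add: word_prod_def)
  moreover have "word_prod v [g] = v g" by (simp add: word_prod_def)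
  ultimately show ?case using Cons by (simp add: word_prod_append star_mult vs)
qed

lemma ev_closed [simp]: "ev v a \<in> carrier A"
  by (simp add: ev_def)

lemma ev_superset:
  assumes "finite S" "Poly_Mapping.keys a \<subseteq> S"
  shows "ev v a = (\<Oplus>w\<in>S. Poly_Mapping.lookup a w \<odot> word_prod v w)"
  unfolding ev_def using assms
  by (intro add.finprod_mono_neutral_cong_left) (auto simp: in_keys_iff)

lemma ev_zero [simp]: "ev v 0 = \<zero>"
  by (simp add: ev_def)

lemma ev_add: "ev v (a + b) = ev v a \<oplus> ev v b"
proof -
  let ?S = "Poly_Mapping.keys a \<union> Poly_Mapping.keys b"
  have *: "finite ?S" "Poly_Mapping.keys a \<subseteq> ?S" "Poly_Mapping.keys b \<subseteq> ?S"
    "Poly_Mapping.keys (a + b) \<subseteq> ?S"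
    using Poly_Mapping.keys_add[of a b] by auto
  have "(\<Oplus>w\<in>?S. Poly_Mapping.lookup (a + b) w \<odot> word_prod v w)
      = (\<Oplus>w\<in>?S. Poly_Mapping.lookup a w \<odot> word_prod v w \<oplus> Poly_Mapping.lookup b w \<odot> word_prod v w)"
    by (simp add: lookup_add smult_l_distr)
  also have "\<dots> = (\<Oplus>w\<in>?S. Poly_Mapping.lookup a w \<odot> word_prod v w)
      \<oplus> (\<Oplus>w\<in>?S. Poly_Mapping.lookup b w \<odot> word_prod v w)"
    by (rule finsum_addf) auto
  finally show ?thesis
    unfolding ev_superset[OF *(1) *(4)] ev_superset[OF *(1) *(2)] ev_superset[OF *(1) *(3)] .
qed

lemma ev_single: "ev v (Poly_Mapping.single w c) = c \<odot> word_prod v w"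
  by (simp add: ev_superset[of "{w}"])

lemma ev_fscale: "ev v (fscale c a) = c \<odot> ev v a"
  by (induction a rule: falg_induct)
     (simp_all add: fscale_add ev_add smult_r_distr fscale_single ev_single smult_assoc,
      simp add: fscale_single_mult)

lemma ev_star: "ev v (fstar a) = star A (ev v a)"
proof (induction a rule: falg_induct)
  case zero
  show ?case using star_smult[of \<zero> 0] by simp
qed (simp_all add: fstar_add ev_add star_add fstar_single ev_single star_smult word_prod_rev)

lemma ev_mult: "ev v (a * b) = ev v a \<otimes> ev v b"
proof (induction a rule: falg_induct)
  case (single w c)
  show ?case
  proof (induction b rule: falg_induct)
    case (single w' d)
    show ?case
      by (simp add: mult_single plus_list_def ev_single word_prod_append smult_mult_left
        smult_mult_right smult_assoc[symmetric] mult.commute)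
  qed (simp_all add: distrib_left ev_add r_distr)
qed (simp_all add: distrib_right ev_add l_distr)

lemma ev_one: "ev v 1 = \<one>"
proof -
  have "word_prod v 0 = \<one>" by (simp add: zero_list_def word_prod_def)
  then show ?thesis using ev_single[of 0 1] by simp
qed

lemma ev_gen: "ev v (gen g) = v g"
  using ev_single[of "[g]" 1] by (simp add: gen_def word_prod_def)

lemma ev_uminus: "ev v (- a) = \<ominus> ev v a"
  using ev_fscale[of "-1" a] by (simp add: fscale_uminus smult_minus_one)

lemma ev_diff: "ev v (a - b) = ev v a \<ominus> ev v b"
  using ev_add[of a "- b"] by (simp add: ev_uminus a_minus_def)

lemma ev_seminorm: "cstar_seminorm (\<lambda>a. cnorm A (ev v a))"
  by (simp add: cstar_seminorm_def ev_add ev_fscale ev_mult ev_star cnorm_triangle cnorm_smult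
      cnorm_mult cstar_identity)

end
end

lemma finsum_ev:
  assumes "cstar_algebra A" "\<And>g. v g \<in> carrier A" "\<And>g. star A (v g) = v g" "finite S"
  shows "cstar_algebra.ev A v (\<Sum>k\<in>S. a k) = (\<Oplus>\<^bsub>A\<^esub>k\<in>S. cstar_algebra.ev A v (a k))"
proof -
  interpret cstar_algebra A by fact
  show ?thesis using assms(4) by induction (simp_all add: assms(2,3) ev_add ev_zero Pi_def ev_closed)
qed

lemma (in cs_seminorm) hom_extension:
  assumes B: "cstar_algebra B" and v: "\<And>g. v g \<in> carrier B" "\<And>g. star B (v g) = v g"
    and le: "\<And>a. cnorm B (cstar_algebra.ev B v a) \<le> p a"
  shows "\<exists>!f. f \<in> cstar_hom K B \<and> f \<in> extensional (carrier K) \<and>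
    (\<forall>g. f (seq_class p (\<lambda>n. gen g)) = v g)"
proof -
  interpret B: cstar_algebra B by fact
  note ev [simp] = B.ev_closed[OF v] B.ev_add[OF v] B.ev_mult[OF v] B.ev_star[OF v]
    B.ev_fscale[OF v] B.ev_one[OF v] B.ev_gen[OF v]
  define e where "e = B.ev v"
  have lim_ex: "\<exists>l. B.tends (\<lambda>n. e (X n)) l" if X: "X \<in> cauchy_seqs p" for X
  proof -
    have "\<exists>l\<in>carrier B. (\<lambda>n. cnorm B (e (X n) \<ominus>\<^bsub>B\<^esub> l)) \<longlonglongrightarrow> 0"
    proof (rule B.complete)
      fix r :: real assume "r > 0"
      then obtain M where "\<forall>m\<ge>M. \<forall>n\<ge>M. p (X m - X n) < r" using cauD[OF X] by blast
      then show "\<exists>M. \<forall>m\<ge>M. \<forall>n\<ge>M. cnorm B (e (X m) \<ominus>\<^bsub>B\<^esub> e (X n)) < r"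
        using le unfolding e_def B.ev_diff[OF v, symmetric] by (meson order.strict_trans1)
    qed (simp add: e_def)
    then show ?thesis by (auto simp: B.tends_def e_def)
  qed
  have lim_eqv: "B.tends (\<lambda>n. e (Y n)) l" if "B.tends (\<lambda>n. e (X n)) l" "eqv X Y" for X Y l
  proof (rule B.tends_bound)
    have l: "l \<in> carrier B" using that B.tends_carrier by blast
    then show "l \<in> carrier B" .
    show "cnorm B (e (Y n) \<ominus>\<^bsub>B\<^esub> l) \<le> p (X n - Y n) + cnorm B (e (X n) \<ominus>\<^bsub>B\<^esub> l)" for n
      using B.cnorm_diff_triangle[of "e (Y n)" "e (X n)" l] le[of "Y n - X n"] l p_swap[of "X n" "Y n"]
      by (simp add: e_def B.ev_diff[OF v])
    show "(\<lambda>n. p (X n - Y n) + cnorm B (e (X n) \<ominus>\<^bsub>B\<^esub> l)) \<longlonglongrightarrow> 0"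
      using tendsto_add[of _ 0 _ _ 0] that unfolding B.tends_def eqv_def by fastforce
  qed (simp add: e_def)
  define F where "F x = (if x \<in> carrier K then THE l. B.tends (\<lambda>n. e (rep x n)) l else undefined)" for x
  have F: "B.tends (\<lambda>n. e (X n)) (F (seq_class p X))" if X: "X \<in> cauchy_seqs p" for X
  proof -
    obtain l where l: "B.tends (\<lambda>n. e (X n)) l" using lim_ex[OF X] by blast
    have "B.tends (\<lambda>n. e (rep (seq_class p X) n)) l"
      using lim_eqv[OF l] rep_seq_class(2)[OF X] eqv_sym by blast
    then have "F (seq_class p X) = l"
      using X B.tends_unique by (auto simp: F_def carrier_completion intro!: the_equality)
    then show ?thesis using l by simp
  qed
  have FI: "F (seq_class p X) = l" if "X \<in> cauchy_seqs p" "B.tends (\<lambda>n. e (X n)) l" for X l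
    using B.tends_unique[OF F[OF that(1)] that(2)] .
  have hom: "F \<in> cstar_hom K B"
    unfolding cstar_hom_def ring_hom_def
  proof (intro CollectI conjI ballI allI impI)
    show "F \<in> carrier K \<rightarrow> carrier B"
      using F B.tends_carrier(2) by (fastforce simp: carrier_completion)
    show "F \<one>\<^bsub>K\<^esub> = \<one>\<^bsub>B\<^esub>"
      by (simp add: completion_simps, rule FI) (simp_all add: e_def)
  next
    fix x y assume "x \<in> carrier K \<and> y \<in> carrier K"
    then obtain X Y where X: "X \<in> cauchy_seqs p" "x = seq_class p X"
      and Y: "Y \<in> cauchy_seqs p" "y = seq_class p Y" by (auto simp: carrier_completion)
    show "F (x \<otimes>\<^bsub>K\<^esub> y) = F x \<otimes>\<^bsub>B\<^esub> F y"
      using B.tends_mult[OF F[OF X(1)] F[OF Y(1)]]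
      by (simp add: X Y completion_simps, intro FI) (simp_all add: X Y completion_simps e_def)
    show "F (x \<oplus>\<^bsub>K\<^esub> y) = F x \<oplus>\<^bsub>B\<^esub> F y"
      using B.tends_add[OF F[OF X(1)] F[OF Y(1)]]
      by (simp add: X Y completion_simps, intro FI) (simp_all add: X Y completion_simps e_def)
  next
    fix x c assume "x \<in> carrier K"
    then obtain X where X: "X \<in> cauchy_seqs p" "x = seq_class p X" by (auto simp: carrier_completion)
    show "F (star K x) = star B (F x)"
      using B.tends_star[OF F[OF X(1)]]
      by (simp add: X completion_simps, intro FI) (simp_all add: X completion_simps e_def)
    show "F (c \<odot>\<^bsub>K\<^esub> x) = c \<odot>\<^bsub>B\<^esub> F x"
      using B.tends_smult[OF F[OF X(1)], of c]
      by (simp add: X completion_simps, intro FI) (simp_all add: X completion_simps e_def)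
  qed
  have gen: "F (seq_class p (\<lambda>n. gen g)) = v g" for g
    by (rule FI) (simp_all add: e_def v)
  show ?thesis
  proof (rule ex1I[of _ F])
    show "F \<in> cstar_hom K B \<and> F \<in> extensional (carrier K) \<and> (\<forall>g. F (seq_class p (\<lambda>n. gen g)) = v g)"
      using hom gen by (auto simp: F_def extensional_def)
    fix f assume f: "f \<in> cstar_hom K B \<and> f \<in> extensional (carrier K) \<and>
      (\<forall>g. f (seq_class p (\<lambda>n. gen g)) = v g)"
    then have f_hom: "f \<in> cstar_hom K B" by blast
    note fD = cstar_homD[OF f_hom]
    interpret K: cstar_algebra K by (rule cstar_completion)
    let ?c = "\<lambda>a. seq_class p (\<lambda>n. a)"
    have cc [simp]: "?c a \<in> carrier K" for a by (simp add: carrier_completion)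
    have word: "f (?c (prod_list (map gen w))) = e (prod_list (map gen w))" for w
    proof (induction w)
      case Nil
      show ?case using fD(4) by (simp add: completion_simps e_def)
    next
      case (Cons g w)
      have "f (?c (gen g * prod_list (map gen w))) = v g \<otimes>\<^bsub>B\<^esub> f (?c (prod_list (map gen w)))"
        using fD(3)[of "?c (gen g)" "?c (prod_list (map gen w))"] f by (simp add: completion_simps)
      then show ?case using Cons by (simp add: e_def)
    qed
    have const: "f (?c a) = e a" for a
    proof (induction a rule: falg_induct)
      case zero
      have "f (0 \<odot>\<^bsub>K\<^esub> ?c 0) = 0 \<odot>\<^bsub>B\<^esub> f (?c 0)" by (rule fD(6)) simp
      then show ?case using fD(1)[of "?c 0"] by (simp add: completion_simps e_def B.ev_zero[OF v] fscale_single_mult)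
    next
      case (single w d)
      have "f (d \<odot>\<^bsub>K\<^esub> ?c (prod_list (map gen w))) = d \<odot>\<^bsub>B\<^esub> f (?c (prod_list (map gen w)))"
        by (rule fD(6)) simp
      then show ?case using word by (simp add: gen_word completion_simps e_def)
    next
      case (add a b)
      then show ?case using fD(2)[of "?c a" "?c b"] by (simp add: completion_simps e_def)
    qed
    show "f = F"
    proof (rule extensionalityI[of _ "carrier K"])
      fix x assume x: "x \<in> carrier K"
      then obtain X where X: "X \<in> cauchy_seqs p" "x = seq_class p X" by (auto simp: carrier_completion)
      have dn: "cnorm B (f y \<ominus>\<^bsub>B\<^esub> f z) \<le> cnorm K (y \<ominus>\<^bsub>K\<^esub> z)" if "y \<in> carrier K" "z \<in> carrier K" for y z
      proof -
        have "f (y \<ominus>\<^bsub>K\<^esub> z) = f y \<ominus>\<^bsub>B\<^esub> f z"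
          using that fD(2)[of y "\<ominus>\<^bsub>K\<^esub> z"] fD(6)[of z "-1"] fD(1)
          by (simp add: a_minus_def K.smult_minus_one B.smult_minus_one)
        then show ?thesis
          using cstar_hom_contractive[OF cstar_completion B f_hom, of "y \<ominus>\<^bsub>K\<^esub> z"] that by simp
      qed
      have "K.tends (\<lambda>n. ?c (X n)) x"
        unfolding K.tends_def
      proof (intro conjI allI LIMSEQ_I)
        fix r :: real assume "r > 0"
        then obtain M where "\<forall>m\<ge>M. cnorm K (x \<ominus>\<^bsub>K\<^esub> ?c (X m)) < r"
          using approx_const[OF X(1)] X(2) by blast
        then show "\<exists>M. \<forall>n\<ge>M. norm (cnorm K (?c (X n) \<ominus>\<^bsub>K\<^esub> x) - 0) < r"
          using x by (auto simp: K.cnorm_swap[of _ x] K.cnorm_nonneg)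
      qed (use x in auto)
      then have "B.tends (\<lambda>n. f (?c (X n))) (f x)"
        using x dn[OF cc x] fD(1)
        by (intro B.tends_bound[of _ _ "\<lambda>n. cnorm K (?c (X n) \<ominus>\<^bsub>K\<^esub> x)"]) (auto simp: K.tends_def)
      then have "B.tends (\<lambda>n. e (X n)) (f x)" by (simp add: const)
      then show "f x = F x" using FI[OF X(1)] X(2) by simp
    qed (use f in \<open>auto simp: F_def extensional_def\<close>)
  qed
qed

theorem C_qperm_universal:
  assumes B: "cstar_algebra B" and v: "magic_unitary B N v"
  shows "\<exists>!f. f \<in> cstar_hom (C_qperm N) B \<and> f \<in> extensional (carrier (C_qperm N)) \<and>
    (\<forall>i\<in>{1..N}. \<forall>j\<in>{1..N}. f (qperm_gen N i j) = v i j)"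
proof -
  let ?p = "universal_seminorm (magic_relations N)"
  interpret cs_seminorm ?p by (rule magic_seminorm)
  interpret B: cstar_algebra B by fact
  define v' where "v' = (\<lambda>(i, j). if i \<in> {1..N} \<and> j \<in> {1..N} then v i j else \<zero>\<^bsub>B\<^esub>)"
  have m: "v i j \<in> carrier B" "star B (v i j) = v i j" "v i j \<otimes>\<^bsub>B\<^esub> v i j = v i j"
    if "i \<in> {1..N}" "j \<in> {1..N}" for i j
    using v that by (auto simp: magic_unitary_def)
  have s0: "star B \<zero>\<^bsub>B\<^esub> = \<zero>\<^bsub>B\<^esub>" using B.star_smult[of "\<zero>\<^bsub>B\<^esub>" 0] by simp
  have v': "v' g \<in> carrier B" "star B (v' g) = v' g" for g
    using m by (auto simp: v'_def s0 split: prod.split)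
  have row: "B.ev v' (\<Sum>j=1..N. gen (i, j)) = \<one>\<^bsub>B\<^esub>" if "i \<in> {1..N}" for i
  proof -
    have "B.ev v' (\<Sum>j=1..N. gen (i, j)) = (\<Oplus>\<^bsub>B\<^esub>j\<in>{1..N}. v i j)"
      using that m unfolding finsum_ev[OF B v' finite_atLeastAtMost]
      by (intro B.finsum_cong') (auto simp: B.ev_gen[OF v'], auto simp: v'_def)
    then show ?thesis using v that by (simp add: magic_unitary_def)
  qed
  have col: "B.ev v' (\<Sum>i=1..N. gen (i, j)) = \<one>\<^bsub>B\<^esub>" if "j \<in> {1..N}" for j
  proof -
    have "B.ev v' (\<Sum>i=1..N. gen (i, j)) = (\<Oplus>\<^bsub>B\<^esub>i\<in>{1..N}. v i j)"
      using that m unfolding finsum_ev[OF B v' finite_atLeastAtMost]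
      by (intro B.finsum_cong') (auto simp: B.ev_gen[OF v'], auto simp: v'_def)
    then show ?thesis using v that by (simp add: magic_unitary_def)
  qed
  have "B.ev v' r = \<zero>\<^bsub>B\<^esub>" if "r \<in> magic_relations N" for r
  proof -
    from that consider
        (idem) i j where "i \<in> {1..N}" "j \<in> {1..N}" "r = gen (i, j) * gen (i, j) - gen (i, j)"
      | (row) i where "i \<in> {1..N}" "r = (\<Sum>j=1..N. gen (i, j)) - 1"
      | (col) j where "j \<in> {1..N}" "r = (\<Sum>i=1..N. gen (i, j)) - 1"
      | (out) i j where "\<not> (i \<in> {1..N} \<and> j \<in> {1..N})" "r = gen (i, j)"
      unfolding magic_relations_def by blast
    then show ?thesis
    proof cases
      case idem
      then have "v' (i, j) = v i j" by (simp add: v'_def)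
      then show ?thesis
        using m[OF idem(1,2)] unfolding idem(3) B.ev_diff[OF v'] B.ev_mult[OF v'] B.ev_gen[OF v']
        by (simp add: a_minus_def B.r_neg)
    next
      case row': row
      show ?thesis
        unfolding row'(2) B.ev_diff[OF v'] row[OF row'(1)] B.ev_one[OF v']
        by (simp add: a_minus_def B.r_neg)
    next
      case col': col
      show ?thesis
        unfolding col'(2) B.ev_diff[OF v'] col[OF col'(1)] B.ev_one[OF v']
        by (simp add: a_minus_def B.r_neg)
    next
      case out
      then have "v' (i, j) = \<zero>\<^bsub>B\<^esub>" by (auto simp: v'_def)
      then show ?thesis unfolding out(2) B.ev_gen[OF v'] .
    qed
  qed
  then have "(\<lambda>a. cnorm B (B.ev v' a)) \<in> admissible (magic_relations N)"
    by (simp add: admissible_def B.ev_seminorm[OF v'])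
  then have le: "cnorm B (B.ev v' a) \<le> ?p a" for a
    using admissible_le[OF magic_bdd] by blast
  have iff: "(\<forall>i\<in>{1..N}. \<forall>j\<in>{1..N}. f (qperm_gen N i j) = v i j) \<longleftrightarrow>
      (\<forall>g. f (seq_class ?p (\<lambda>n. gen g)) = v' g)" if f: "f \<in> cstar_hom (C_qperm N) B" for f
  proof
    assume r: "\<forall>i\<in>{1..N}. \<forall>j\<in>{1..N}. f (qperm_gen N i j) = v i j"
    show "\<forall>g. f (seq_class ?p (\<lambda>n. gen g)) = v' g"
    proof
      fix g :: "nat \<times> nat"
      obtain i j where g: "g = (i, j)" by (cases g)
      show "f (seq_class ?p (\<lambda>n. gen g)) = v' g"
      proof (cases "i \<in> {1..N} \<and> j \<in> {1..N}")
        case True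
        then show ?thesis using r by (simp add: g v'_def qperm_gen_def)
      next
        case False
        then have "gen g \<in> magic_relations N" unfolding g magic_relations_def by blast
        then have "?p (gen g) = 0"
          using universal_admissible[OF magic_bdd, of N] by (simp add: admissible_def)
        then have z: "seq_class ?p (\<lambda>n. gen g) = \<zero>\<^bsub>C_qperm N\<^esub>"
          by (simp add: C_qperm_def completion_simps seq_class_eq eqv_def)
        interpret C: cstar_algebra "C_qperm N" by (rule cstar_C_qperm)
        have "f (0 \<odot>\<^bsub>C_qperm N\<^esub> \<zero>\<^bsub>C_qperm N\<^esub>) = 0 \<odot>\<^bsub>B\<^esub> f \<zero>\<^bsub>C_qperm N\<^esub>"
          by (rule cstar_homD(6)[OF f]) simp
        then have "f \<zero>\<^bsub>C_qperm N\<^esub> = \<zero>\<^bsub>B\<^esub>" using cstar_homD(1)[OF f, of "\<zero>\<^bsub>C_qperm N\<^esub>"] by simp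
        moreover have "v' g = \<zero>\<^bsub>B\<^esub>" using False by (auto simp: g v'_def)
        ultimately show ?thesis unfolding z by (rule trans[OF _ sym])
      qed
    qed
  next
    assume r: "\<forall>g. f (seq_class ?p (\<lambda>n. gen g)) = v' g"
    show "\<forall>i\<in>{1..N}. \<forall>j\<in>{1..N}. f (qperm_gen N i j) = v i j"
      using r by (simp add: qperm_gen_def v'_def)
  qed
  have "(f \<in> cstar_hom (C_qperm N) B \<and> f \<in> extensional (carrier (C_qperm N)) \<and>
        (\<forall>i\<in>{1..N}. \<forall>j\<in>{1..N}. f (qperm_gen N i j) = v i j)) \<longleftrightarrow>
      (f \<in> cstar_hom (C_qperm N) B \<and> f \<in> extensional (carrier (C_qperm N)) \<and>
        (\<forall>g. f (seq_class ?p (\<lambda>n. gen g)) = v' g))" for f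
    using iff[of f] by argo
  then show ?thesis
    using hom_extension[OF B v' le] unfolding C_qperm_def[symmetric] by presburger
qed

section \<open>The quotient map and the two sets of states\<close>

definition corner_block :: "nat \<Rightarrow> nat \<Rightarrow> nat \<Rightarrow> (nat \<Rightarrow> (nat \<times> nat) falg) set" where
  "corner_block M i j =
     (if i \<in> {1..M} \<and> j \<in> {1..M} then qperm_gen M i j
      else if i = j then \<one>\<^bsub>C_qperm M\<^esub> else \<zero>\<^bsub>C_qperm M\<^esub>)"

text \<open>The quotient map \<open>\<pi>\<^sub>M\<close> from \<open>C_qperm (Suc M)\<close> to \<open>C_qperm M\<close>; existence and uniqueness are
  \<open>C_qperm_universal\<close> applied to \<open>magic_corner_block\<close>.\<close>

definition corner_hom ::
    "nat \<Rightarrow> (nat \<Rightarrow> (nat \<times> nat) falg) set \<Rightarrow> (nat \<Rightarrow> (nat \<times> nat) falg) set" where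
  "corner_hom M = (THE \<pi>. \<pi> \<in> cstar_hom (C_qperm (Suc M)) (C_qperm M) \<and>
     \<pi> \<in> extensional (carrier (C_qperm (Suc M))) \<and>
     (\<forall>i\<in>{1..Suc M}. \<forall>j\<in>{1..Suc M}. \<pi> (qperm_gen (Suc M) i j) = corner_block M i j))"

lemma magic_corner_block: "magic_unitary (C_qperm M) (Suc M) (corner_block M)"
proof -
  interpret C: cstar_algebra "C_qperm M" by (rule cstar_C_qperm)
  note m = magic_qperm_gen[of M, unfolded magic_unitary_def]
  have s0: "star (C_qperm M) \<zero>\<^bsub>C_qperm M\<^esub> = \<zero>\<^bsub>C_qperm M\<^esub>"
    using C.star_smult[of "\<zero>\<^bsub>C_qperm M\<^esub>" 0] by simp
  have entry: "corner_block M i j \<in> carrier (C_qperm M)"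
      "star (C_qperm M) (corner_block M i j) = corner_block M i j"
      "corner_block M i j \<otimes>\<^bsub>C_qperm M\<^esub> corner_block M i j = corner_block M i j" for i j
    using m by (auto simp: corner_block_def s0)
  have split: "(\<Oplus>\<^bsub>C_qperm M\<^esub>k\<in>{1..Suc M}. f k) = f (Suc M) \<oplus>\<^bsub>C_qperm M\<^esub> (\<Oplus>\<^bsub>C_qperm M\<^esub>k\<in>{1..M}. f k)"
    if "\<And>k. f k \<in> carrier (C_qperm M)" for f
  proof -
    have "{1..Suc M} = insert (Suc M) {1..M}" by auto
    then show ?thesis using that by (simp add: Pi_def)
  qed
  have row: "(\<Oplus>\<^bsub>C_qperm M\<^esub>j\<in>{1..Suc M}. corner_block M i j) = \<one>\<^bsub>C_qperm M\<^esub>" if i: "i \<in> {1..Suc M}" for i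
  proof (cases "i = Suc M")
    case True
    have "(\<Oplus>\<^bsub>C_qperm M\<^esub>j\<in>{1..M}. corner_block M i j) = (\<Oplus>\<^bsub>C_qperm M\<^esub>j\<in>{1..M}. \<zero>\<^bsub>C_qperm M\<^esub>)"
      using True by (intro C.finsum_cong') (auto simp: corner_block_def)
    then show ?thesis using True by (simp only: split[OF entry(1)]) (simp add: corner_block_def)
  next
    case False
    have "(\<Oplus>\<^bsub>C_qperm M\<^esub>j\<in>{1..M}. corner_block M i j) = (\<Oplus>\<^bsub>C_qperm M\<^esub>j\<in>{1..M}. qperm_gen M i j)"
      using False i m by (intro C.finsum_cong') (auto simp: corner_block_def)
    also have "\<dots> = \<one>\<^bsub>C_qperm M\<^esub>" using False i m by auto
    finally show ?thesis using False by (simp only: split[OF entry(1)]) (simp add: corner_block_def)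
  qed
  have col: "(\<Oplus>\<^bsub>C_qperm M\<^esub>i\<in>{1..Suc M}. corner_block M i j) = \<one>\<^bsub>C_qperm M\<^esub>" if j: "j \<in> {1..Suc M}" for j
  proof (cases "j = Suc M")
    case True
    have "(\<Oplus>\<^bsub>C_qperm M\<^esub>i\<in>{1..M}. corner_block M i j) = (\<Oplus>\<^bsub>C_qperm M\<^esub>i\<in>{1..M}. \<zero>\<^bsub>C_qperm M\<^esub>)"
      using True by (intro C.finsum_cong') (auto simp: corner_block_def)
    then show ?thesis using True by (simp only: split[OF entry(1)]) (simp add: corner_block_def)
  next
    case False
    have "(\<Oplus>\<^bsub>C_qperm M\<^esub>i\<in>{1..M}. corner_block M i j) = (\<Oplus>\<^bsub>C_qperm M\<^esub>i\<in>{1..M}. qperm_gen M i j)"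
      using False j m by (intro C.finsum_cong') (auto simp: corner_block_def)
    also have "\<dots> = \<one>\<^bsub>C_qperm M\<^esub>" using False j m by auto
    finally show ?thesis using False by (simp only: split[OF entry(1)]) (simp add: corner_block_def)
  qed
  show ?thesis unfolding magic_unitary_def using entry row col by blast
qed

theorem corner_hom:
  "corner_hom M \<in> cstar_hom (C_qperm (Suc M)) (C_qperm M)"
  "corner_hom M \<in> extensional (carrier (C_qperm (Suc M)))"
  "i \<in> {1..Suc M} \<Longrightarrow> j \<in> {1..Suc M} \<Longrightarrow> corner_hom M (qperm_gen (Suc M) i j) = corner_block M i j"
  using theI'[OF C_qperm_universal[OF cstar_C_qperm magic_corner_block, of M]]
  unfolding corner_hom_def[symmetric] by blast+

text \<open>The set of all \<open>\<phi> \<circ> \<pi>\<^bsub>N-1\<^esub>\<close>, with the composition taken on the carrier.\<close>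

definition pulled_back_states ::
    "nat \<Rightarrow> ((nat \<Rightarrow> (nat \<times> nat) falg) set \<Rightarrow> complex) set" where
  "pulled_back_states N =
     {compose (carrier (C_qperm N)) \<phi> (corner_hom (N - 1)) |\<phi>. \<phi> \<in> states (C_qperm (N - 1))}"

definition stabilizer_states ::
    "nat \<Rightarrow> ((nat \<Rightarrow> (nat \<times> nat) falg) set \<Rightarrow> complex) set" where
  "stabilizer_states N = {\<phi> \<in> states (C_qperm N). \<phi> (qperm_gen N N N) = 1}"

end

(* A pulled-back state cannot distinguish u_11 u_NN u_11 from u_11, because the quotient map sends
   u_NN to 1. To find a state of the stabilizer that does, take two non-commuting projections p, q on
   C^2 and the block-diagonal magic unitary with blocks [p, 1-p; 1-p, p], 1, [q, 1-q; 1-q, q], which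
   needs N >= 4. The vector state of a unit vector e in the range of q sends u_NN = q to 1, while
   <e, p q p e> = 1/4 and <e, p e> = 1/2 if p is the projection onto a line at 45 degrees to e. *)

theory Submission
  imports "HOL-Analysis.Bounded_Linear_Function" Defs
begin

section \<open>Operators commuting with a complex structure\<close>

lemma inner_adjoint:
  fixes T :: "'v::euclidean_space \<Rightarrow>\<^sub>L 'v"
  shows "x \<bullet> adjoint T y = T x \<bullet> y" "adjoint T x \<bullet> y = x \<bullet> T y"
  by (simp_all add: adjoint_works adjoint_clauses(2) bounded_linear.linear[OF blinfun.bounded_linear_right])

text \<open>\<open>adjoint\<close> acts on plain functions; repackaging it as a bounded operator
  lets the operator norm apply to it. In finite dimension every linear map is bounded, so
  \<open>Blinfun\<close> is well behaved here.\<close>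

definition blinfun_adjoint :: "('v::euclidean_space \<Rightarrow>\<^sub>L 'v) \<Rightarrow> 'v \<Rightarrow>\<^sub>L 'v" where
  "blinfun_adjoint T = Blinfun (adjoint T)"

lemma blinfun_adjoint_apply: "blinfun_adjoint T x = adjoint T x"
  unfolding blinfun_adjoint_def
  by (simp add: bounded_linear_Blinfun_apply linear_conv_bounded_linear[symmetric] adjoint_linear
      bounded_linear.linear[OF blinfun.bounded_linear_right])

lemma inner_blinfun_adjoint:
  "x \<bullet> blinfun_adjoint T y = T x \<bullet> y" "blinfun_adjoint T x \<bullet> y = x \<bullet> T y"
  by (simp_all add: blinfun_adjoint_apply inner_adjoint)

lemma blinfun_eq_innerI:
  fixes S T :: "'v::euclidean_space \<Rightarrow>\<^sub>L 'v"
  assumes "\<And>x y. x \<bullet> S y = x \<bullet> T y"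
  shows "S = T"
  using assms by (intro blinfun_eqI) (metis vector_eq_rdot inner_commute)

text \<open>This is the C*-identity. Cauchy-Schwarz applied to
  \<open>x \<bullet> (blinfun_adjoint S o\<^sub>L S) x\<close>, the square of
  \<open>norm (S x)\<close>, gives one inequality. It also shows that no operator has larger norm
  than its adjoint; for the adjoint of \<open>T\<close> this yields the other inequality.\<close>

lemma norm_blinfun_adjoint_compose:
  "norm (blinfun_adjoint T o\<^sub>L T) = (norm T)\<^sup>2"
proof (rule antisym)
  have norm_le: "norm (S x) \<le> sqrt (norm (blinfun_adjoint S o\<^sub>L S)) * norm x" for S :: "'a \<Rightarrow>\<^sub>L 'a" and x
  proof (rule power2_le_imp_le)
    have "(norm (S x))\<^sup>2 = x \<bullet> (blinfun_adjoint S o\<^sub>L S) x"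
      by (simp add: power2_norm_eq_inner inner_blinfun_adjoint)
    also have "\<dots> \<le> norm x * norm ((blinfun_adjoint S o\<^sub>L S) x)"
      by (rule norm_cauchy_schwarz)
    also have "\<dots> \<le> norm x * (norm (blinfun_adjoint S o\<^sub>L S) * norm x)"
      by (intro mult_left_mono norm_blinfun) auto
    finally show "(norm (S x))\<^sup>2 \<le> (sqrt (norm (blinfun_adjoint S o\<^sub>L S)) * norm x)\<^sup>2"
      by (simp add: power_mult_distrib power2_eq_square mult_ac)
  qed auto
  then have *: "(norm S)\<^sup>2 \<le> norm (blinfun_adjoint S o\<^sub>L S)" for S :: "'a \<Rightarrow>\<^sub>L 'a"
    using power_mono[OF norm_blinfun_bound[OF _ norm_le], of S 2] by simp
  then show "(norm T)\<^sup>2 \<le> norm (blinfun_adjoint T o\<^sub>L T)" .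
  have aa: "blinfun_adjoint (blinfun_adjoint T) = T"
    by (rule blinfun_eq_innerI) (simp add: inner_blinfun_adjoint)
  have "norm S \<le> norm (blinfun_adjoint S)" for S :: "'a \<Rightarrow>\<^sub>L 'a"
  proof (cases "norm S = 0")
    case False
    have "norm S * norm S \<le> norm (blinfun_adjoint S) * norm S"
      using order_trans[OF * norm_blinfun_compose, of S] by (simp add: power2_eq_square)
    then show ?thesis using False by simp
  qed simp
  from this[of "blinfun_adjoint T"] have "norm (blinfun_adjoint T) \<le> norm T" by (simp add: aa)
  then show "norm (blinfun_adjoint T o\<^sub>L T) \<le> (norm T)\<^sup>2"
    unfolding power2_eq_square
    by (intro order_trans[OF norm_blinfun_compose] mult_right_mono) auto
qed

section \<open>The C*-algebra of complex-linear operators\<close>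

text \<open>A complex Hilbert space is encoded as a real one with a skew-adjoint \<open>J\<close> that plays the role
  of multiplication by \<open>\<i>\<close>; complex-linear then means commuting with \<open>J\<close>, and the complex inner
  product \<open>\<langle>x, y\<rangle>\<close>, linear in \<open>y\<close>, has real part \<open>x \<bullet> y\<close> and imaginary part \<open>J x \<bullet> y\<close>.\<close>

locale complex_structure =
  fixes J :: "'v::euclidean_space \<Rightarrow>\<^sub>L 'v"
  assumes J_J [simp]: "J (J x) = - x"
    and J_skew: "J x \<bullet> y = - (x \<bullet> J y)"
begin

text \<open>These are all complex-linear operators, hence a full complex matrix algebra. For
  operators commuting with \<open>J\<close> the real adjoint and the real operator norm agree with
  the complex ones, so both are reused.\<close>

definition operators :: "('v \<Rightarrow>\<^sub>L 'v) cstar" where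
  "operators = \<lparr>
     carrier = {T :: 'v \<Rightarrow>\<^sub>L 'v. \<forall>x. T (J x) = J (T x)},
     mult = (o\<^sub>L),
     one = id_blinfun,
     zero = 0,
     add = (+),
     smult = (\<lambda>c T. Re c *\<^sub>R T + Im c *\<^sub>R (J o\<^sub>L T)),
     star = blinfun_adjoint,
     cnorm = norm\<rparr>"

lemma operators_simps [simp]:
  "T \<in> carrier operators \<longleftrightarrow> (\<forall>x. T (J x) = J (T x))"
  "S \<otimes>\<^bsub>operators\<^esub> T = S o\<^sub>L T" "\<one>\<^bsub>operators\<^esub> = id_blinfun"
  "\<zero>\<^bsub>operators\<^esub> = 0" "S \<oplus>\<^bsub>operators\<^esub> T = S + T"
  "c \<odot>\<^bsub>operators\<^esub> T = Re c *\<^sub>R T + Im c *\<^sub>R (J o\<^sub>L T)"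
  "star operators T = blinfun_adjoint T" "cnorm operators T = norm T"
  by (simp_all add: operators_def)

lemmas blinfun_simps = blinfun.add_left blinfun.add_right blinfun.diff_left blinfun.diff_right
  blinfun.scaleR_left blinfun.scaleR_right blinfun.minus_left blinfun.minus_right

lemma ring_operators: "ring operators"
proof (rule ringI)
  show "abelian_group operators"
  proof (rule abelian_groupI)
    fix T assume "T \<in> carrier operators"
    then show "\<exists>S\<in>carrier operators. S \<oplus>\<^bsub>operators\<^esub> T = \<zero>\<^bsub>operators\<^esub>"
      by (intro bexI[of _ "- T"]) (auto simp: blinfun_simps)
  qed (auto simp: blinfun_simps)
  show "monoid operators"
    by (rule monoidI) (auto intro: blinfun_eqI)
qed (auto intro!: blinfun_eqI simp: blinfun_simps)

lemma minus_operators: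
  assumes "S \<in> carrier operators" "T \<in> carrier operators"
  shows "S \<ominus>\<^bsub>operators\<^esub> T = S - T"
proof -
  interpret ring operators by (rule ring_operators)
  have "\<ominus>\<^bsub>operators\<^esub> T = - T"
    using assms by (intro minus_equality) (auto simp: blinfun_simps)
  then show ?thesis by (simp add: a_minus_def)
qed

lemma finsum_operators:
  assumes "finite S" "\<And>k. k \<in> S \<Longrightarrow> T k \<in> carrier operators"
  shows "(\<Oplus>\<^bsub>operators\<^esub>k\<in>S. T k) = (\<Sum>k\<in>S. T k)"
proof -
  interpret ring operators by (rule ring_operators)
  show ?thesis
    using assms
  proof (induction S)
    case (insert k S)
    then have "(\<Oplus>\<^bsub>operators\<^esub>k\<in>insert k S. T k) = T k \<oplus>\<^bsub>operators\<^esub> (\<Oplus>\<^bsub>operators\<^esub>k\<in>S. T k)"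
      by (intro finsum_insert) blast+
    then show ?case using insert by simp
  qed simp
qed

lemma inner_J_self [simp]: "x \<bullet> J x = 0"
  using J_skew[of x x] by (simp add: inner_commute)

text \<open>Pythagoras: \<open>x\<close> and \<open>J x\<close> are orthogonal and of equal
  length.\<close>

lemma norm_complex_scale: "norm (a *\<^sub>R x + b *\<^sub>R J x) = sqrt (a\<^sup>2 + b\<^sup>2) * norm x"
proof -
  have "J x \<bullet> J x = x \<bullet> x" by (simp add: J_skew)
  then have "(norm (a *\<^sub>R x + b *\<^sub>R J x))\<^sup>2 = (a\<^sup>2 + b\<^sup>2) * (norm x)\<^sup>2"
    unfolding power2_norm_eq_inner
    by (simp add: inner_add_left inner_add_right inner_commute[of "J x" x] power2_eq_square[of a]
        power2_eq_square[of b] algebra_simps)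
  then have "(norm (a *\<^sub>R x + b *\<^sub>R J x))\<^sup>2 = (sqrt (a\<^sup>2 + b\<^sup>2) * norm x)\<^sup>2"
    by (simp add: power_mult_distrib)
  then show ?thesis by (rule power2_eq_imp_eq) auto
qed

text \<open>The bound from above holds pointwise by \<open>norm_complex_scale\<close>; the bound
  from below is the same estimate for the scalar \<open>inverse c\<close>.\<close>

lemma norm_smult_operators: "norm (c \<odot>\<^bsub>operators\<^esub> T) = cmod c * norm T"
proof -
  have le: "norm (d \<odot>\<^bsub>operators\<^esub> S) \<le> cmod d * norm S" for d S
  proof (rule norm_blinfun_bound)
    fix x
    have "norm ((d \<odot>\<^bsub>operators\<^esub> S) x) = cmod d * norm (S x)"
      by (simp add: blinfun_simps norm_complex_scale cmod_def)
    then show "norm ((d \<odot>\<^bsub>operators\<^esub> S) x) \<le> cmod d * norm S * norm x"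
      using norm_blinfun[of S x] by (simp add: mult.assoc mult_left_mono)
  qed simp
  show ?thesis
  proof (cases "c = 0")
    case False
    have "inverse c \<odot>\<^bsub>operators\<^esub> (c \<odot>\<^bsub>operators\<^esub> T) = (inverse c * c) \<odot>\<^bsub>operators\<^esub> T"
      by (rule blinfun_eqI) (simp add: blinfun_simps algebra_simps del: left_inverse)
    then have "norm T \<le> cmod (inverse c) * norm (c \<odot>\<^bsub>operators\<^esub> T)"
      using le[of "inverse c" "c \<odot>\<^bsub>operators\<^esub> T"] False by simp
    then have "cmod c * norm T \<le> norm (c \<odot>\<^bsub>operators\<^esub> T)"
      using False unfolding norm_inverse
      by (metis divide_inverse_commute mult.commute pos_le_divide_eq zero_less_norm_iff)
    then show ?thesis using le by (intro antisym)
  qed simp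
qed

lemma cstar_operators: "cstar_algebra operators"
proof (intro cstar_algebra.intro ring_operators cstar_algebra_axioms.intro)
  fix S T :: "'v \<Rightarrow>\<^sub>L 'v" and c d :: complex
  assume S: "S \<in> carrier operators"
  note s = blinfun_simps inner_blinfun_adjoint inner_add_left inner_add_right inner_diff_right
  show "c \<odot>\<^bsub>operators\<^esub> S \<in> carrier operators" using S by (simp add: blinfun_simps)
  show "(c + d) \<odot>\<^bsub>operators\<^esub> S = c \<odot>\<^bsub>operators\<^esub> S \<oplus>\<^bsub>operators\<^esub> d \<odot>\<^bsub>operators\<^esub> S"
    by (simp add: algebra_simps)
  show "(c * d) \<odot>\<^bsub>operators\<^esub> S = c \<odot>\<^bsub>operators\<^esub> (d \<odot>\<^bsub>operators\<^esub> S)"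
    by (rule blinfun_eqI) (simp add: blinfun_simps algebra_simps)
  show "1 \<odot>\<^bsub>operators\<^esub> S = S" by simp
  \<comment> \<open>The adjoint of \<open>J\<close> is \<open>- J\<close>. Moving \<open>J\<close>
    across the inner product twice cancels the signs, so the adjoint of \<open>S\<close> again
    commutes with \<open>J\<close>.\<close>
  have "x \<bullet> blinfun_adjoint S (J y) = x \<bullet> J (blinfun_adjoint S y)" for x y
  proof -
    have "x \<bullet> blinfun_adjoint S (J y) = - (J (S x) \<bullet> y)"
      by (simp add: inner_blinfun_adjoint J_skew)
    also have "\<dots> = - (J x \<bullet> blinfun_adjoint S y)" using S by (simp add: inner_blinfun_adjoint)
    finally show ?thesis by (simp add: J_skew)
  qed
  then show "star operators S \<in> carrier operators"
    by simp (metis vector_eq_ldot)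
  show "star operators (star operators S) = S"
    by (rule blinfun_eq_innerI) (simp add: inner_blinfun_adjoint)
  show "star operators (c \<odot>\<^bsub>operators\<^esub> S) = cnj c \<odot>\<^bsub>operators\<^esub> star operators S"
  proof (rule blinfun_eq_innerI)
    fix x y
    \<comment> \<open>Here only one sign arises; it turns \<open>Im c\<close> into
      \<open>- Im c\<close>, which is the conjugation of the scalar.\<close>
    have "J (S x) \<bullet> y = - (x \<bullet> J (blinfun_adjoint S y))"
      using S J_skew[of x "blinfun_adjoint S y"] by (simp add: inner_blinfun_adjoint)
    then show "x \<bullet> star operators (c \<odot>\<^bsub>operators\<^esub> S) y = x \<bullet> (cnj c \<odot>\<^bsub>operators\<^esub> star operators S) y"
      by (simp add: s)
  qed
  show "cnorm operators (c \<odot>\<^bsub>operators\<^esub> S) = cmod c * cnorm operators S"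
    using norm_smult_operators by simp
  show "cnorm operators (star operators S \<otimes>\<^bsub>operators\<^esub> S) = (cnorm operators S)\<^sup>2"
    by (simp add: norm_blinfun_adjoint_compose)
  show "cnorm operators S = 0 \<Longrightarrow> S = \<zero>\<^bsub>operators\<^esub>" by simp
  show "c \<odot>\<^bsub>operators\<^esub> (S \<oplus>\<^bsub>operators\<^esub> T) = c \<odot>\<^bsub>operators\<^esub> S \<oplus>\<^bsub>operators\<^esub> c \<odot>\<^bsub>operators\<^esub> T"
    by (rule blinfun_eqI) (simp add: blinfun_simps algebra_simps)
  show "(c \<odot>\<^bsub>operators\<^esub> S) \<otimes>\<^bsub>operators\<^esub> T = c \<odot>\<^bsub>operators\<^esub> (S \<otimes>\<^bsub>operators\<^esub> T)"
    by (rule blinfun_eqI) (simp add: blinfun_simps)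
  show "S \<otimes>\<^bsub>operators\<^esub> (c \<odot>\<^bsub>operators\<^esub> T) = c \<odot>\<^bsub>operators\<^esub> (S \<otimes>\<^bsub>operators\<^esub> T)"
    using S by (intro blinfun_eqI) (simp add: blinfun_simps)
  show "star operators (S \<oplus>\<^bsub>operators\<^esub> T) = star operators S \<oplus>\<^bsub>operators\<^esub> star operators T"
    by (rule blinfun_eq_innerI) (simp add: s)
  show "star operators (S \<otimes>\<^bsub>operators\<^esub> T) = star operators T \<otimes>\<^bsub>operators\<^esub> star operators S"
    by (rule blinfun_eq_innerI) (simp add: s)
  show "cnorm operators (S \<oplus>\<^bsub>operators\<^esub> T) \<le> cnorm operators S + cnorm operators T"
    by (simp add: norm_triangle_ineq)
  show "cnorm operators (S \<otimes>\<^bsub>operators\<^esub> T) \<le> cnorm operators S * cnorm operators T"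
    by (simp add: norm_blinfun_compose)
next
  fix X :: "nat \<Rightarrow> 'v \<Rightarrow>\<^sub>L 'v" assume X: "\<And>n. X n \<in> carrier operators"
    and C: "\<And>e. e > 0 \<Longrightarrow> \<exists>M. \<forall>m\<ge>M. \<forall>n\<ge>M. cnorm operators (X m \<ominus>\<^bsub>operators\<^esub> X n) < e"
  have "Cauchy X"
    using C unfolding minus_operators[OF X X] operators_simps by (rule CauchyI)
  then obtain L where L: "X \<longlonglongrightarrow> L" by (auto simp: Cauchy_convergent_iff convergent_def)
  \<comment> \<open>A limit exists among all bounded operators; commuting with \<open>J\<close>
    passes to it pointwise, so the carrier is closed.\<close>
  have "L (J x) = J (L x)" for x
  proof (rule LIMSEQ_unique)
    show "(\<lambda>n. X n (J x)) \<longlonglongrightarrow> L (J x)" by (intro blinfun.tendsto L tendsto_const)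
    have "X n (J x) = J (X n x)" for n using X[of n] by simp
    then show "(\<lambda>n. X n (J x)) \<longlonglongrightarrow> J (L x)"
      by (simp only:) (intro blinfun.tendsto L tendsto_const)
  qed
  then have Lc: "L \<in> carrier operators" unfolding operators_simps by blast
  moreover have "(\<lambda>n. cnorm operators (X n \<ominus>\<^bsub>operators\<^esub> L)) \<longlonglongrightarrow> 0"
    unfolding minus_operators[OF X Lc] operators_simps
    by (rule tendsto_norm_zero[OF LIM_zero[OF L]])
  ultimately show "\<exists>L\<in>carrier operators. (\<lambda>n. cnorm operators (X n \<ominus>\<^bsub>operators\<^esub> L)) \<longlonglongrightarrow> 0"
    by (rule bexI[rotated])
qed

section \<open>Vector states\<close>

definition vector_state :: "'v \<Rightarrow> ('v \<Rightarrow>\<^sub>L 'v) \<Rightarrow> complex" where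
  "vector_state e = restrict (\<lambda>T :: 'v \<Rightarrow>\<^sub>L 'v. Complex (e \<bullet> T e) (J e \<bullet> T e)) (carrier operators)"

text \<open>Positivity: at the product of the adjoint of \<open>T\<close> with \<open>T\<close> the
  value is the squared length of \<open>T e\<close>, with imaginary part zero because
  \<open>J (T e)\<close> is orthogonal to \<open>T e\<close>. Linearity over complex scalars uses
  that \<open>J\<close> preserves inner products.\<close>

lemma vector_state: assumes "norm e = 1" shows "vector_state e \<in> states operators"
proof -
  interpret cstar_algebra operators by (rule cstar_operators)
  have e: "e \<bullet> e = 1" using assms by (simp add: dot_square_norm)
  have [simp]: "J e \<bullet> J x = e \<bullet> x" for x by (simp add: J_skew)
  have pos: "vector_state e (star operators T \<otimes>\<^bsub>operators\<^esub> T) \<in> \<real>\<^sub>\<ge>\<^sub>0" if T: "T \<in> carrier operators" for T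
  proof -
    have "star operators T \<otimes>\<^bsub>operators\<^esub> T \<in> carrier operators" using T by (intro m_closed star_closed)
    then have "vector_state e (star operators T \<otimes>\<^bsub>operators\<^esub> T) = Complex (T e \<bullet> T e) (J (T e) \<bullet> T e)"
      using T by (simp add: vector_state_def inner_blinfun_adjoint)
    also have "\<dots> = complex_of_real (T e \<bullet> T e)"
      by (simp add: complex_eq_iff inner_commute[of "J _"])
    finally show ?thesis by simp
  qed
  show ?thesis
    unfolding states_def
  proof (intro CollectI conjI ballI allI pos)
    fix S T c assume S: "S \<in> carrier operators"
    then have "c \<odot>\<^bsub>operators\<^esub> S \<in> carrier operators" by (rule smult_closed)
    then show "vector_state e (c \<odot>\<^bsub>operators\<^esub> S) = c * vector_state e S"
      using S by (simp add: vector_state_def complex_eq_iff blinfun_simps inner_add_right J_skew algebra_simps)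
    assume T: "T \<in> carrier operators"
    have "S \<oplus>\<^bsub>operators\<^esub> T \<in> carrier operators" using S T by (rule a_closed)
    then show "vector_state e (S \<oplus>\<^bsub>operators\<^esub> T) = vector_state e S + vector_state e T"
      using S T by (simp add: vector_state_def complex_eq_iff blinfun_simps inner_add_right)
  qed (simp_all add: vector_state_def complex_eq_iff e inner_commute[of "J e"])
qed

section \<open>Magic unitaries from projections and an involution of the indices\<close>

text \<open>Where \<open>\<sigma>\<close> fixes \<open>i\<close>, the two contributions to the entry \<open>(i, i)\<close> overlap and add up to \<open>1\<close>.\<close>

lemma magic_involution:
  fixes r :: "nat \<Rightarrow> 'v \<Rightarrow>\<^sub>L 'v" and \<sigma> :: "nat \<Rightarrow> nat"
  assumes r: "\<And>i. r i \<in> carrier operators" "\<And>i. blinfun_adjoint (r i) = r i" "\<And>i. r i o\<^sub>L r i = r i"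
    and \<sigma>: "\<And>i. \<sigma> (\<sigma> i) = i" "\<And>i. r (\<sigma> i) = r i" "\<And>i. i \<in> {1..N} \<Longrightarrow> \<sigma> i \<in> {1..N}"
  shows "magic_unitary operators N
    (\<lambda>i j. (if j = i then r i else 0) + (if j = \<sigma> i then id_blinfun - r i else 0))"
    (is "magic_unitary _ _ ?v")
proof -
  have entry: "?v i j = 0 \<or> ?v i j = id_blinfun \<or> ?v i j = r i \<or> ?v i j = id_blinfun - r i" for i j
    by auto
  have adj: "blinfun_adjoint 0 = (0 :: 'v \<Rightarrow>\<^sub>L 'v)"
    "blinfun_adjoint id_blinfun = (id_blinfun :: 'v \<Rightarrow>\<^sub>L 'v)"
    "blinfun_adjoint (id_blinfun - r i) = id_blinfun - r i" for i
    using r(2)[of i] inner_blinfun_adjoint(1)[of _ "r i"]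
    by (auto intro!: blinfun_eq_innerI simp: inner_blinfun_adjoint blinfun_simps inner_diff_left inner_diff_right)
  have idem: "(id_blinfun - r i) o\<^sub>L (id_blinfun - r i) = id_blinfun - r i" for i
    using arg_cong[OF r(3)[of i], of blinfun_apply]
    by (intro blinfun_eqI) (simp add: blinfun_simps fun_eq_iff)
  have c: "?v i j \<in> carrier operators" for i j
    using r(1)[of i] entry[of i j] by (auto simp: blinfun_simps)
  \<comment> \<open>Since \<sigma> is an involution and \<open>r\<close> is constant on its orbits,
    the matrix is symmetric, and the column sums reduce to the row sums.\<close>
  have sym: "?v i j = ?v j i" for i j
    using \<sigma>(1,2) by (cases "j = \<sigma> i"; cases "i = \<sigma> j") auto
  \<comment> \<open>Row \<open>i\<close> sums to \<open>r i + (id_blinfun - r i)\<close>; both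
    positions \<open>i\<close> and \<open>\<sigma> i\<close> lie in the index range.\<close>
  have row: "(\<Oplus>\<^bsub>operators\<^esub>j\<in>{1..N}. ?v i j) = \<one>\<^bsub>operators\<^esub>" if "i \<in> {1..N}" for i
    using that \<sigma>(3)[OF that] by (simp add: finsum_operators[OF _ c] sum.distrib)
  show ?thesis
    unfolding magic_unitary_def
  proof (intro conjI ballI)
    fix i j
    show "star operators (?v i j) = ?v i j" "?v i j \<otimes>\<^bsub>operators\<^esub> ?v i j = ?v i j"
      using entry[of i j] adj r(2)[of i] r(3)[of i] idem[of i] by (auto intro: blinfun_eqI)
  next
    fix j assume "j \<in> {1..N}"
    then show "(\<Oplus>\<^bsub>operators\<^esub>i\<in>{1..N}. ?v i j) = \<one>\<^bsub>operators\<^esub>" by (subst sym) (rule row)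
  qed (use c row in auto)
qed

end

section \<open>Two non-commuting projections on the plane\<close>

text \<open>The listed values exclude that \<open>p\<close> and \<open>q\<close> commute:
  \<open>q\<close> fixes \<open>e\<close>, so commuting projections would give
  \<open>p o\<^sub>L q o\<^sub>L p\<close> and \<open>p\<close> the same value at
  \<open>e\<close>.\<close>

lemma noncommuting_projections:
  obtains J p q :: "(complex \<times> complex) \<Rightarrow>\<^sub>L (complex \<times> complex)" and e
  where "complex_structure J"
    "p \<in> carrier (complex_structure.operators J)" "blinfun_adjoint p = p" "p o\<^sub>L p = p"
    "q \<in> carrier (complex_structure.operators J)" "blinfun_adjoint q = q" "q o\<^sub>L q = q"
    "norm e = 1" "complex_structure.vector_state J e q = 1"
    "complex_structure.vector_state J e p = 1/2"
    "complex_structure.vector_state J e (p o\<^sub>L q o\<^sub>L p) = 1/4"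
proof -
  define J where "J = Blinfun (\<lambda>(a, b). (\<i> * a, \<i> * b) :: complex \<times> complex)"
  define q where "q = Blinfun (\<lambda>(a, b :: complex). (a, 0) :: complex \<times> complex)"
  define p where "p = Blinfun (\<lambda>(a, b). ((a + b) / 2, (a + b) / 2) :: complex \<times> complex)"
  have J [simp]: "J (a, b) = (\<i> * a, \<i> * b)" for a b
    unfolding J_def by (subst bounded_linear_Blinfun_apply)
      (auto simp: linear_conv_bounded_linear[symmetric] linear_iff algebra_simps)
  have q [simp]: "q (a, b) = (a, 0)" for a b
    unfolding q_def by (subst bounded_linear_Blinfun_apply)
      (auto simp: linear_conv_bounded_linear[symmetric] linear_iff algebra_simps)
  have p [simp]: "p (a, b) = ((a + b) / 2, (a + b) / 2)" for a b
    unfolding p_def by (subst bounded_linear_Blinfun_apply)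
      (auto simp: linear_conv_bounded_linear[symmetric] linear_iff algebra_simps add_divide_distrib
        scaleR_conv_of_real)
  have cs: "complex_structure J"
    by unfold_locales (auto simp: inner_complex_def)
  then interpret complex_structure J .
  have c: "p \<in> carrier operators" "q \<in> carrier operators"
    by (auto simp: algebra_simps add_divide_distrib)
  have "blinfun_adjoint p = p" "blinfun_adjoint q = q"
    by (auto intro!: blinfun_eq_innerI simp: inner_blinfun_adjoint inner_complex_def field_simps)
  moreover have "p o\<^sub>L p = p" "q o\<^sub>L q = q"
    by (auto intro!: blinfun_eqI)
  moreover have "norm (1 :: complex, 0 :: complex) = 1" by simp
  \<comment> \<open>With \<open>e = (1, 0)\<close>, applying \<open>p\<close>, \<open>q\<close> and
    \<open>p\<close> in turn gives \<open>(1/2, 1/2)\<close>, \<open>(1/2, 0)\<close> and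
    \<open>(1/4, 1/4)\<close>; the first coordinates are the values.\<close>
  moreover have "vector_state (1, 0) q = 1" "vector_state (1, 0) p = 1/2"
    "vector_state (1, 0) (p o\<^sub>L q o\<^sub>L p) = 1/4"
    using c by (auto simp: vector_state_def complex_eq_iff inner_complex_def)
  ultimately show ?thesis using that cs c by blast
qed

section \<open>Pulling back states\<close>

lemma states_compose:
  assumes A: "cstar_algebra A" and f: "f \<in> cstar_hom A B" and \<phi>: "\<phi> \<in> states B"
  shows "compose (carrier A) \<phi> f \<in> states A"
proof -
  interpret A: cstar_algebra A by fact
  note [simp] = cstar_homD[OF f]
  show ?thesis using \<phi> by (auto simp: states_def compose_def)
qed

text \<open>The quotient map is multiplicative and sends the corner generator to the unit, so the
  middle factor disappears before the state is applied.\<close>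

lemma pulled_back_states_corner:
  assumes \<psi>: "\<psi> \<in> pulled_back_states N" and x: "x \<in> carrier (C_qperm N)" and N: "N \<ge> 1"
    and y: "y \<in> carrier (C_qperm N)"
  shows "\<psi> (x \<otimes>\<^bsub>C_qperm N\<^esub> qperm_gen N N N \<otimes>\<^bsub>C_qperm N\<^esub> y) = \<psi> (x \<otimes>\<^bsub>C_qperm N\<^esub> y)"
proof -
  interpret A: cstar_algebra "C_qperm N" by (rule cstar_C_qperm)
  interpret B: cstar_algebra "C_qperm (N - 1)" by (rule cstar_C_qperm)
  have u: "qperm_gen N N N \<in> carrier (C_qperm N)"
    using magic_qperm_gen[of N] N by (auto simp: magic_unitary_def)
  have S: "Suc (N - 1) = N" using N by simp
  note hom = cstar_homD[OF corner_hom(1)[of "N - 1", unfolded S]]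
  \<comment> \<open>The index \<open>N\<close> lies outside \<open>{1..N - 1}\<close>, so
    \<open>corner_block\<close> takes its diagonal value, the unit.\<close>
  have "corner_hom (N - 1) (qperm_gen N N N) = \<one>\<^bsub>C_qperm (N - 1)\<^esub>"
    using corner_hom(3)[of N "N - 1" N] N by (auto simp: corner_block_def)
  with \<psi> x y u show ?thesis
    by (auto simp: pulled_back_states_def compose_def hom simp del: One_nat_def)
qed

text \<open>Taking both outer factors in \<open>pulled_back_states_corner\<close> to be the unit
  gives the value 1 at the corner generator.\<close>

lemma pulled_back_subset_stabilizer:
  assumes N: "N \<ge> 1"
  shows "pulled_back_states N \<subseteq> stabilizer_states N"
proof
  fix \<psi> assume \<psi>: "\<psi> \<in> pulled_back_states N"
  interpret A: cstar_algebra "C_qperm N" by (rule cstar_C_qperm)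
  have S: "Suc (N - 1) = N" using N by simp
  have st: "\<psi> \<in> states (C_qperm N)"
    using \<psi> states_compose[OF cstar_C_qperm corner_hom(1)[of "N - 1", unfolded S]]
    by (auto simp: pulled_back_states_def)
  have "qperm_gen N N N \<in> carrier (C_qperm N)"
    using magic_qperm_gen[of N] N by (auto simp: magic_unitary_def)
  then have "\<psi> (qperm_gen N N N) = 1"
    using pulled_back_states_corner[OF \<psi> A.one_closed N A.one_closed] st by (simp add: states_def)
  with st show "\<psi> \<in> stabilizer_states N" by (simp add: stabilizer_states_def)
qed

theorem proposition3p3:
  fixes N :: nat
  assumes "N \<ge> 4"
  shows "pulled_back_states N \<subset> stabilizer_states N"
proof -
  obtain J p q :: "(complex \<times> complex) \<Rightarrow>\<^sub>L (complex \<times> complex)" and e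
    where J: "complex_structure J"
      and p: "p \<in> carrier (complex_structure.operators J)" "blinfun_adjoint p = p" "p o\<^sub>L p = p"
      and q: "q \<in> carrier (complex_structure.operators J)" "blinfun_adjoint q = q" "q o\<^sub>L q = q"
      and e: "norm e = 1" "complex_structure.vector_state J e q = 1"
        "complex_structure.vector_state J e p = 1/2"
        "complex_structure.vector_state J e (p o\<^sub>L q o\<^sub>L p) = 1/4"
    by (rule noncommuting_projections)
  interpret complex_structure J by fact
  interpret A: cstar_algebra "C_qperm N" by (rule cstar_C_qperm)
  \<comment> \<open>Projections are assigned to indices so as to be constant on the orbits of
    \<sigma>: \<open>p\<close> on the first two indices, \<open>q\<close> on the last two. In
    between, \<sigma> fixes the index and the diagonal entry is the identity.\<close>
  define r where "r i = (if i \<in> {1, 2} then p else if i \<in> {N - 1, N} then q else id_blinfun)" for i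
  define \<sigma> where "\<sigma> i = (if i = 1 then 2 else if i = 2 then 1
    else if i = N - 1 then N else if i = N then N - 1 else i)" for i
  define v where "v i j = (if j = i then r i else 0) + (if j = \<sigma> i then id_blinfun - r i else 0)" for i j
  have id: "blinfun_adjoint id_blinfun = (id_blinfun :: (complex \<times> complex) \<Rightarrow>\<^sub>L _)"
    by (rule blinfun_eq_innerI) (simp add: inner_blinfun_adjoint)
  have "magic_unitary operators N v"
    unfolding v_def
  proof (rule magic_involution)
    fix i
    show "r i \<in> carrier operators" "blinfun_adjoint (r i) = r i" "r i o\<^sub>L r i = r i"
      using p q id by (auto simp: r_def intro: blinfun_eqI)
    \<comment> \<open>The bound on \<open>N\<close> makes the pairs \<open>{1, 2}\<close> and
      \<open>{N - 1, N}\<close> disjoint; otherwise the two swaps would interfere.\<close>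
    show "\<sigma> (\<sigma> i) = i" "r (\<sigma> i) = r i" "i \<in> {1..N} \<Longrightarrow> \<sigma> i \<in> {1..N}"
      using assms by (auto simp: r_def \<sigma>_def)
  qed
  from C_qperm_universal[OF cstar_operators this] obtain f where
    f: "f \<in> cstar_hom (C_qperm N) operators"
    and fv: "\<forall>i\<in>{1..N}. \<forall>j\<in>{1..N}. f (qperm_gen N i j) = v i j"
    by blast
  define \<psi> where "\<psi> = compose (carrier (C_qperm N)) (vector_state e) f"
  let ?u = "qperm_gen N 1 1" and ?w = "qperm_gen N N N"
  have u: "?u \<in> carrier (C_qperm N)" "?w \<in> carrier (C_qperm N)" "?u \<otimes>\<^bsub>C_qperm N\<^esub> ?u = ?u"
    using magic_qperm_gen[of N] assms by (auto simp: magic_unitary_def)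
  \<comment> \<open>Neither 1 nor \<open>N\<close> is fixed by \<sigma>, so only the first summand
    of \<open>v\<close> contributes at these diagonal entries.\<close>
  have fu: "f ?u = p" "f ?w = q"
    using fv assms by (auto simp: v_def r_def \<sigma>_def)
  have \<psi>_u: "\<psi> ?u = 1/2" "\<psi> ?w = 1" "\<psi> (?u \<otimes>\<^bsub>C_qperm N\<^esub> ?w \<otimes>\<^bsub>C_qperm N\<^esub> ?u) = 1/4"
    using u e by (simp_all add: \<psi>_def compose_def cstar_homD(3)[OF f] fu del: One_nat_def)
  have "\<psi> \<in> states (C_qperm N)"
    unfolding \<psi>_def by (rule states_compose[OF cstar_C_qperm f vector_state[OF e(1)]])
  then have "\<psi> \<in> stabilizer_states N" using \<psi>_u by (simp add: stabilizer_states_def)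
  moreover have "\<psi> \<notin> pulled_back_states N"
  proof
    assume "\<psi> \<in> pulled_back_states N"
    \<comment> \<open>Both outer factors are the idempotent \<open>?u\<close>, so removing the
      corner generator leaves \<open>?u\<close> itself, with value 1/2 instead of 1/4.\<close>
    from pulled_back_states_corner[OF this u(1) _ u(1)] have "(1/4 :: complex) = 1/2"
      using assms unfolding u(3) \<psi>_u by simp
    then show False by (simp add: field_simps)
  qed
  ultimately show ?thesis using pulled_back_subset_stabilizer[of N] assms by auto
qed

end
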